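(* Let $\mathsf{A} \subset \mathbf{M}_d(\mathbb{C})$ be a nonempty compact set indexed in $\mathcal{I}$, and let $|\!|\!|\cdot|\!|\!|$ be a submultiplicative norm on $\mathbf{M}_d(\mathbb{C})$ (that is, a norm with $|\!|\!|AB|\!|\!|\leq |\!|\!|A|\!|\!|\,|\!|\!|B|\!|\!|$ for all $A,B\in \mathbf{M}_d(\mathbb{C})$). Then \begin{align*} \log\varrho(\mathsf{A})&=\sup_{\mu \in \mathcal{M}_\sigma} \inf_{n \geq 1}\frac{1}{n}\int_{\Sigma_{\mathcal{I}}} \log|\!|\!|\mathcal{L}_{\mathsf{A}}(x,n)|\!|\!|\,d\mu(x) \\ &= \inf_{n \geq 1}\sup_{\mu \in \mathcal{M}_\sigma}\frac{1}{n}\int_{\Sigma_{\mathcal{I}}} \log|\!|\!|\mathcal{L}_{\mathsf{A}}(x,n)|\!|\!|\,d\mu(x)\\ &= \sup_{x \in \Sigma_{\mathcal{I}}} \inf_{n \geq 1} \frac{1}{n}\log|\!|\!|\mathcal{L}_{\mathsf{A}}(x,n)|\!|\!|. \end{align*} In the first two expressions every supremum over $\mathcal{M}_\sigma$ (in the second expression, for every $n\ge 1$) is attained by some ergodic measure, and in the last expression the supremum is attained for at least one $x \in \Sigma_{\mathcal{I}}$. Furthermore, in each of the first two expressions, the infimum over all $n \geq 1$ may be replaced with a limit as $n \to \infty$ without affecting the validity of the expression.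
   Context: $\mathbf{M}_d(\mathbb{C})$ is the set of $d\times d$ complex matrices; $\|\cdot\|$ is the Euclidean norm on $\mathbb{C}^d$ and the induced operator norm on $\mathbf{M}_d(\mathbb{C})$. Convention: $\log 0=-\infty$. The joint spectral radius of a bounded set $\mathsf{A}\subset\mathbf{M}_d(\mathbb{C})$ is $\varrho(\mathsf{A})=\lim_{n\to\infty}\sup\{\|A_1\cdots A_n\|^{1/n}\colon A_1,\dots,A_n\in\mathsf{A}\}$ (the limit exists and equals the infimum over $n\ge1$). A compact set $\mathsf{A}$ is indexed in $\mathcal{I}$ if $\mathcal{I}$ is a compact metric space equipped with a continuous surjection $\mathcal{I}\to\mathsf{A}$, $i\mapsto A_i$ (not necessarily injective). $\Sigma_{\mathcal{I}}=\mathcal{I}^{\mathbb{N}}$ is the space of one-sided sequences $x=(x_i)_{i=1}^\infty$ with the product topology, and $\sigma[(x_i)_{i\ge1}]=(x_{i+1})_{i\ge1}$ is the shift. $\mathcal{M}_\sigma$ is the set of $\sigma$-invariant Borel probability measures on $\Sigma_{\mathcal{I}}$. For $x\in\Sigma_{\mathcal{I}}$ and $n\ge1$, $\mathcal{L}_{\mathsf{A}}(x,n):=A_{x_n}A_{x_{n-1}}\cdots A_{x_1}$. *)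

theory Defs
  imports "HOL-Probability.Probability"
begin

definition submult_norm :: "(complex^'d^'d \<Rightarrow> real) \<Rightarrow> bool" where
  "submult_norm N \<longleftrightarrow>
     (\<forall>A. 0 \<le> N A) \<and>
     (\<forall>A. N A = 0 \<longleftrightarrow> A = 0) \<and>
     (\<forall>c A. N (\<chi> i j. c * A $ i $ j) = cmod c * N A) \<and>
     (\<forall>A B. N (A + B) \<le> N A + N B) \<and>
     (\<forall>A B. N (A ** B) \<le> N A * N B)"

text \<open>The overloaded constant \<open>norm\<close> is the Frobenius norm on matrices, so the operator
  norm induced by the Euclidean norm is written with \<open>onorm\<close>.\<close>

definition op_norm :: "complex^'d^'d \<Rightarrow> real" where
  "op_norm A = onorm (\<lambda>v. A *v v)"

text \<open>The least upper bound is that of a bounded set of reals only if \<open>A\<close> is nonempty and bounded;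
  the value is unspecified otherwise. The term at \<open>n = 0\<close> does not affect the limit.\<close>

definition joint_spectral_radius :: "(complex^'d^'d) set \<Rightarrow> real" where
  "joint_spectral_radius A =
     lim (\<lambda>n. SUP w \<in> {w. length w = n \<and> set w \<subseteq> A}. root n (op_norm (foldr (**) w (mat 1))))"

definition indexed_by ::
  "(complex^'d^'d) set \<Rightarrow> 'i::metric_space set \<Rightarrow> ('i \<Rightarrow> complex^'d^'d) \<Rightarrow> bool" where
  "indexed_by A I a \<longleftrightarrow> compact I \<and> continuous_on I a \<and> a ` I = A"

text \<open>Sequences are indexed from 0, so \<open>x k\<close> stands for the entry conventionally written \<open>x\<^sub>k\<^sub>+\<^sub>1\<close>.\<close>

definition seq_space :: "'i set \<Rightarrow> (nat \<Rightarrow> 'i) set" where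
  "seq_space I = {x. \<forall>k. x k \<in> I}"

definition shift :: "(nat \<Rightarrow> 'i) \<Rightarrow> (nat \<Rightarrow> 'i)" where
  "shift x = (\<lambda>k. x (Suc k))"

primrec cocycle :: "('i \<Rightarrow> complex^'d^'d) \<Rightarrow> (nat \<Rightarrow> 'i) \<Rightarrow> nat \<Rightarrow> complex^'d^'d" where
  "cocycle a x 0 = mat 1"
| "cocycle a x (Suc n) = a (x n) ** cocycle a x n"

text \<open>Here \<open>borel\<close> on functions is generated by the product topology, so its restriction is the
  Borel sigma-algebra of the subspace \<open>seq_space I\<close>.\<close>

definition invariant_measures :: "'i::metric_space set \<Rightarrow> (nat \<Rightarrow> 'i) measure set" where
  "invariant_measures I =
     {\<mu>. sets \<mu> = sets (restrict_space borel (seq_space I)) \<and> prob_space \<mu> \<and> distr \<mu> \<mu> shift = \<mu>}"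

definition ergodic :: "(nat \<Rightarrow> 'i) measure \<Rightarrow> bool" where
  "ergodic \<mu> \<longleftrightarrow>
     (\<forall>B \<in> sets \<mu>. shift -` B \<inter> space \<mu> = B \<longrightarrow> measure \<mu> B = 0 \<or> measure \<mu> B = 1)"

text \<open>The logarithm of a nonnegative real, with value \<open>- \<infinity>\<close> at 0 (the library has \<open>ln 0 = 0\<close>).\<close>

definition elog :: "real \<Rightarrow> ereal" where
  "elog t = (if t = 0 then - \<infinity> else ereal (ln t))"

text \<open>Integral of an extended-real function as the difference of the integrals of its positive and
  negative parts; \<open>e2ennreal\<close> sends negative arguments to 0. Meaningful when at least one part is
  finite, as is the case for functions bounded above on a probability space.\<close>

definition eintegral :: "'a measure \<Rightarrow> ('a \<Rightarrow> ereal) \<Rightarrow> ereal" where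
  "eintegral \<mu> f =
     enn2ereal (\<integral>\<^sup>+ x. e2ennreal (f x) \<partial>\<mu>) - enn2ereal (\<integral>\<^sup>+ x. e2ennreal (- f x) \<partial>\<mu>)"

definition mean_log ::
  "(complex^'d^'d \<Rightarrow> real) \<Rightarrow> ('i \<Rightarrow> complex^'d^'d) \<Rightarrow> (nat \<Rightarrow> 'i) measure \<Rightarrow> nat \<Rightarrow> ereal" where
  "mean_log N a \<mu> n = ereal (1 / real n) * eintegral \<mu> (\<lambda>x. elog (N (cocycle a x n)))"

end

theory Submission
  imports Defs
begin

text \<open>
  Write \<open>f\<^sub>n(x)\<close> for the logarithm of the norm of the \<open>n\<close>-th cocycle product at \<open>x\<close>; this is a
  subadditive sequence of upper semicontinuous functions on a compact space. By Fekete's lemma the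
  logarithm of the joint spectral radius, \<open>log \<rho>\<close>, is \<open>inf\<^sub>n sup\<^sub>x f\<^sub>n(x) / n\<close>, which bounds all the other
  expressions from above. Conversely, compactness and concatenation of short products produce a
  sequence \<open>y\<close> with \<open>f\<^sub>n(y) \<ge> n log \<rho>\<close> for all \<open>n \<ge> 1\<close>, and a weak limit of the empirical measures
  along the orbit of \<open>y\<close> is an invariant measure \<open>\<mu>\<close> with \<open>\<integral> f\<^sub>n d\<mu> \<ge> n log \<rho>\<close> for all \<open>n \<ge> 1\<close>. The measures
  with this property, and likewise the maximizers of \<open>\<integral> f\<^sub>n d\<mu>\<close> for a fixed \<open>n\<close>, form a weakly closed face
  of the set of invariant measures. Maximizing a strictly convex, weakly continuous functional over
  such a face yields an ergodic element of it, so no ergodic decomposition is needed.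
\<close>

section \<open>Embedding compact metric spaces into the real line\<close>

text \<open>Three obstacles shape the proof. The logarithm of a norm is \<open>- \<infinity>\<close>
  wherever the product vanishes, so weak convergence does not apply to it directly; lower bounds on
  its integral are proved for the deficit \<open>K - elog (F x)\<close> capped at a level
  \<open>j\<close>, which is continuous, and \<open>j\<close> then tends to infinity by monotone
  convergence. Second, \<open>I\<close> is an arbitrary compact metric space, while weak compactness
  comes from Helly selection on the real line; a Borel code with a continuous decoder carries
  measures there and back. Third, equality of the first two expressions needs one invariant measure
  that is good for all \<open>n\<close> at once, and the expression for single sequences contains an
  infimum, not a limit. The extremal sequence must therefore satisfy
  \<open>R ^ k \<le> N (cocycle a y k)\<close> with constant 1 for every \<open>k \<ge> 1\<close>.
  It is first obtained with a constant \<open>\<theta> < 1\<close> and finitely many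
  \<open>k\<close>, and then \<open>\<theta>\<close> tends to 1 in a compactness argument.\<close>

lemma compact_countable_base:
  fixes X :: "'a::metric_space set"
  assumes "compact X" "X \<noteq> {}"
  obtains U :: "nat \<Rightarrow> 'a set"
  where "\<And>k. open (U k)" "\<And>x e. x \<in> X \<Longrightarrow> 0 < e \<Longrightarrow> \<exists>k. x \<in> U k \<and> U k \<subseteq> ball x e"
proof -
  have "\<exists>F. finite F \<and> F \<subseteq> X \<and> X \<subseteq> (\<Union>p\<in>F. ball p (1 / Suc n))" for n
    using compactE_image[of X X "\<lambda>p. ball p (1 / Suc n)"] assms(1)
    by (metis UN_I centre_in_ball of_nat_0_less_iff open_ball subsetI zero_less_Suc zero_less_divide_1_iff)
  then obtain F where F: "\<And>n. finite (F n)" "\<And>n. F n \<subseteq> X" "\<And>n. X \<subseteq> (\<Union>p\<in>F n. ball p (1 / Suc n))"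
    by metis
  define V where "V = (\<Union>n. (\<lambda>p. ball p (1 / Suc n)) ` F n)"
  have cV: "countable V"
    unfolding V_def by (rule countable_UN) (simp_all add: countable_finite F(1))
  have "V \<noteq> {}"
    using F(3)[of 0] assms(2) by (auto simp: V_def)
  then have rV: "range (from_nat_into V) = V"
    using cV by simp
  show ?thesis
  proof
    show "open (from_nat_into V k)" for k
      using from_nat_into[OF \<open>V \<noteq> {}\<close>, of k] by (auto simp: V_def)
    fix x and e :: real assume x: "x \<in> X" and e: "0 < e"
    \<comment> \<open>The covering ball is centred at some \<open>p\<close>, not at
      \<open>x\<close>; it stays inside \<open>ball x e\<close> because two of its points are less
      than \<open>2 / Suc n\<close> apart.\<close>
    obtain n where n: "1 / Suc n < e / 2"
      using e by (meson half_gt_zero nat_approx_posE)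
    obtain p where p: "p \<in> F n" "x \<in> ball p (1 / Suc n)"
      using F(3)[of n] x by auto
    have "ball p (1 / Suc n) \<subseteq> ball x e"
    proof
      fix y assume "y \<in> ball p (1 / Suc n)"
      then show "y \<in> ball x e"
        using p(2) n dist_triangle2[of x y p] by (simp add: dist_commute)
    qed
    moreover have "ball p (1 / Suc n) \<in> range (from_nat_into V)"
      unfolding rV using p(1) unfolding V_def by blast
    ultimately show "\<exists>k. x \<in> from_nat_into V k \<and> from_nat_into V k \<subseteq> ball x e"
      using p(2) by (metis imageE)
  qed
qed

lemma ternary_summable:
  fixes c :: "nat \<Rightarrow> real"
  assumes "\<And>i. \<bar>c i\<bar> \<le> 1"
  shows "summable (\<lambda>i. c i * (1/3)^i)"
proof (rule summable_comparison_test[OF _ summable_geometric[of "1/3::real"]])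
  show "\<exists>N. \<forall>n\<ge>N. norm (c n * (1/3)^n) \<le> (1/3)^n"
    using assms by (auto simp: abs_mult intro!: mult_left_le_one_le)
qed simp

text \<open>At the first index \<open>j\<close> where the digits differ the terms differ by
  \<open>(1/3)^j\<close>, while all later terms together contribute at most half of that. In base 2
  the tail could cancel the leading difference and distinct digit sequences could share a code,
  hence base 3.\<close>

lemma ternary_separation:
  fixes c d :: "nat \<Rightarrow> real"
  assumes c: "\<And>i. c i \<in> {0,1}" and d: "\<And>i. d i \<in> {0,1}" and k: "c k \<noteq> d k"
  shows "(1/3)^k / 2 \<le> \<bar>(\<Sum>i. c i * (1/3)^i) - (\<Sum>i. d i * (1/3)^i)\<bar>"
proof -
  define b where "b i = c i - d i" for i
  have b1: "\<bar>b i\<bar> \<le> 1" for i using c[of i] d[of i] by (auto simp: b_def)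
  define j where "j = (LEAST i. b i \<noteq> 0)"
  have bk: "b k \<noteq> 0" using k by (simp add: b_def)
  have bj: "b j \<noteq> 0" unfolding j_def using bk by (rule LeastI)
  have jk: "j \<le> k" unfolding j_def using bk by (rule Least_le)
  have b0: "b i = 0" if "i < j" for i using that not_less_Least unfolding j_def by blast
  have sb: "summable (\<lambda>i. b i * (1/3)^i)" using b1 by (rule ternary_summable)
  have "\<bar>c i\<bar> \<le> 1" "\<bar>d i\<bar> \<le> 1" for i using c[of i] d[of i] by auto
  then have "(\<Sum>i. c i * (1/3)^i) - (\<Sum>i. d i * (1/3)^i) = (\<Sum>i. b i * (1/3)^i)"
    by (subst suminf_diff) (auto intro: ternary_summable simp: b_def algebra_simps)
  also have "\<dots> = (\<Sum>i. b (i + Suc j) * (1/3)^(i + Suc j)) + (\<Sum>i<Suc j. b i * (1/3)^i)"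
    by (rule suminf_split_initial_segment[OF sb])
  also have "(\<Sum>i<Suc j. b i * (1/3)^i) = b j * (1/3)^j"
    using b0 by simp
  finally have eq: "(\<Sum>i. c i * (1/3)^i) - (\<Sum>i. d i * (1/3)^i)
    = (\<Sum>i. b (i + Suc j) * (1/3)^(i + Suc j)) + b j * (1/3)^j" .
  have gs: "(\<lambda>i. (1/3::real)^(i + Suc j)) sums ((1/3)^j / 2)"
    using sums_mult[OF geometric_sums[of "1/3::real"], of "(1/3)^Suc j"]
    by (simp add: power_add algebra_simps)
  have "norm (\<Sum>i. b (i + Suc j) * (1/3)^(i + Suc j)) \<le> (\<Sum>i. (1/3)^(i + Suc j))"
  proof (rule norm_suminf_le)
    fix i
    show "norm (b (i + Suc j) * (1/3)^(i + Suc j)) \<le> (1/3)^(i + Suc j)"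
      using b1[of "i + Suc j"] by (simp add: abs_mult mult_left_le_one_le)
  qed (use gs in \<open>simp add: sums_iff\<close>)
  then have t: "\<bar>\<Sum>i. b (i + Suc j) * (1/3)^(i + Suc j)\<bar> \<le> (1/3)^j / 2"
    using gs by (simp add: sums_iff)
  have "\<bar>b j\<bar> = 1" using bj c[of j] d[of j] by (auto simp: b_def)
  then have "\<bar>b j * (1/3)^j\<bar> = (1/3)^j" by (simp add: abs_mult)
  with t eq have "(1/3)^j / 2 \<le> \<bar>(\<Sum>i. c i * (1/3)^i) - (\<Sum>i. d i * (1/3)^i)\<bar>"
    by linarith
  moreover have "(1/3::real)^k \<le> (1/3)^j" using jk by (intro power_decreasing) auto
  ultimately show ?thesis by linarith
qed

text \<open>The points of \<open>X\<close> are coded by the ternary expansion with digits \<open>indicator (U i) x\<close>. The code \<open>s\<close> is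
  only Borel, but its inverse extends continuously to the closure: codes of sequences with different
  limits stay apart.\<close>

lemma compact_borel_real_section:
  fixes X :: "'a::metric_space set"
  assumes X: "compact X" "X \<noteq> {}"
  obtains s :: "'a \<Rightarrow> real" and K \<pi>
  where "s \<in> borel_measurable (restrict_space borel X)" "compact K" "continuous_on K \<pi>"
    "\<pi> ` K \<subseteq> X" "\<And>x. x \<in> X \<Longrightarrow> s x \<in> K" "\<And>x. x \<in> X \<Longrightarrow> \<pi> (s x) = x"
proof -
  obtain U :: "nat \<Rightarrow> 'a set" where U: "\<And>k. open (U k)"
    "\<And>x e. x \<in> X \<Longrightarrow> 0 < e \<Longrightarrow> \<exists>k. x \<in> U k \<and> U k \<subseteq> ball x e"
    using compact_countable_base[OF X] by blast
  define s where "s x = (\<Sum>i. indicator (U i) x * (1/3::real)^i)" for x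
  have "s \<in> borel_measurable borel"
    unfolding s_def using U(1)
    by (intro borel_measurable_suminf borel_measurable_times borel_measurable_indicator
        borel_open borel_measurable_const)
  then have sm: "s \<in> borel_measurable (restrict_space borel X)"
    by (rule measurable_restrict_space1)
  have bd: "s x \<in> {0..2}" for x
  proof -
    have sm: "summable (\<lambda>i. indicator (U i) x * (1/3::real)^i)"
      by (rule ternary_summable) (simp add: indicator_def)
    have "s x \<le> (\<Sum>i. (1/3::real)^i)"
      unfolding s_def using sm
      by (intro suminf_le) (auto simp: indicator_def summable_geometric)
    also have "\<dots> \<le> 2" by (simp add: suminf_geometric)
    finally show ?thesis
      unfolding s_def using sm by (auto intro!: suminf_nonneg)
  qed
  \<comment> \<open>\<open>Z\<close> is compact. Once \<open>fst\<close> is shown to be injective on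
    it, \<open>Z\<close> is the graph of a function of the first coordinate, continuous by
    compactness; this function is the decoder \<open>\<pi>\<close>.\<close>
  define Z where "Z = closure ((\<lambda>x. (s x, x)) ` X)"
  have Zsub: "Z \<subseteq> {0..2} \<times> X"
    unfolding Z_def using bd X(1)
    by (intro closure_minimal closed_Times compact_imp_closed) auto
  have "compact Z"
  proof -
    have "compact ({0..2::real} \<times> X)" using X(1) by (intro compact_Times) auto
    then show ?thesis
      using Zsub closed_closure by (metis Z_def compact_Int_closed inf.absorb_iff2)
  qed
  have approx: "\<exists>u. (\<forall>n. u n \<in> X) \<and> (\<lambda>n. (s (u n), u n)) \<longlonglongrightarrow> p" if p: "p \<in> Z" for p
  proof -
    obtain w where w: "\<And>n. w n \<in> (\<lambda>x. (s x, x)) ` X" "w \<longlonglongrightarrow> p"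
      using p unfolding Z_def closure_sequential by blast
    have "(s (snd (w n)), snd (w n)) = w n" "snd (w n) \<in> X" for n
      using w(1)[of n] by auto
    then show ?thesis using w(2) by (intro exI[of _ "\<lambda>n. snd (w n)"]) simp
  qed
  have "inj_on fst Z"
  proof (rule inj_onI)
    fix p q assume p: "p \<in> Z" and q: "q \<in> Z" and eq: "fst p = fst q"
    show "p = q"
    proof (rule ccontr)
      assume "p \<noteq> q"
      define x where "x = snd p"
      define y where "y = snd q"
      have xy: "x \<noteq> y" using \<open>p \<noteq> q\<close> eq by (simp add: x_def y_def prod_eq_iff)
      have xX: "x \<in> X" using Zsub p by (auto simp: x_def)
      obtain k where k: "x \<in> U k" "U k \<subseteq> ball x (dist x y / 2)"
        using U(2)[OF xX, of "dist x y / 2"] xy by auto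
      obtain u where u: "\<And>n. u n \<in> X" "(\<lambda>n. (s (u n), u n)) \<longlonglongrightarrow> p"
        using approx[OF p] by blast
      obtain v where v: "\<And>n. v n \<in> X" "(\<lambda>n. (s (v n), v n)) \<longlonglongrightarrow> q"
        using approx[OF q] by blast
      have ux: "u \<longlonglongrightarrow> x" and su: "(\<lambda>n. s (u n)) \<longlonglongrightarrow> fst p"
        using tendsto_snd[OF u(2)] tendsto_fst[OF u(2)] by (simp_all add: x_def)
      have vy: "v \<longlonglongrightarrow> y" and sv: "(\<lambda>n. s (v n)) \<longlonglongrightarrow> fst p"
        using tendsto_snd[OF v(2)] tendsto_fst[OF v(2)] eq by (simp_all add: y_def)
      have e1: "\<forall>\<^sub>F n in sequentially. u n \<in> U k"
        using topological_tendstoD[OF ux U(1) k(1)] .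
      have "y \<in> - cball x (dist x y / 2)" using xy by simp
      then have e2: "\<forall>\<^sub>F n in sequentially. v n \<in> - cball x (dist x y / 2)"
        using topological_tendstoD[OF vy, of "- cball x (dist x y / 2)"] by auto
      \<comment> \<open>Eventually \<open>u n\<close> lies in \<open>U k\<close> and
        \<open>v n\<close> outside it, so digit \<open>k\<close> differs and the codes stay a fixed
        distance apart. But both code sequences tend to \<open>fst p\<close>.\<close>
      have "\<forall>\<^sub>F n in sequentially. (1/3)^k / 2 \<le> \<bar>s (u n) - s (v n)\<bar>"
        using e1 e2
      proof eventually_elim
        case (elim n)
        then have "v n \<notin> U k" using k(2) by (auto simp: subset_iff)
        with elim(1) show ?case
          unfolding s_def by (intro ternary_separation) (auto simp: indicator_def)
      qed
      moreover have "(\<lambda>n. \<bar>s (u n) - s (v n)\<bar>) \<longlonglongrightarrow> \<bar>fst p - fst p\<bar>"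
        by (intro tendsto_intros su sv)
      ultimately have "(1/3)^k / 2 \<le> \<bar>fst p - fst p\<bar>"
        by (intro tendsto_lowerbound) auto
      moreover have "0 < (1/3::real)^k" by simp
      ultimately show False by linarith
    qed
  qed
  moreover have "continuous_on Z fst" by (intro continuous_intros)
  ultimately obtain g where g: "homeomorphism Z (fst ` Z) fst g"
    using homeomorphism_compact[OF \<open>compact Z\<close>] by blast
  have sZ: "(s x, x) \<in> Z" if "x \<in> X" for x
    unfolding Z_def using that closure_subset by fastforce
  show ?thesis
  proof
    show "compact (fst ` Z)"
      by (intro compact_continuous_image \<open>compact Z\<close> continuous_intros)
    show "continuous_on (fst ` Z) (snd \<circ> g)"
      using g by (auto simp: homeomorphism_def intro!: continuous_on_compose continuous_intros)
    show "(snd \<circ> g) ` (fst ` Z) \<subseteq> X"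
      using g Zsub by (fastforce simp: homeomorphism_def)
    show "s x \<in> fst ` Z" if "x \<in> X" for x using sZ[OF that] by force
    show "(snd \<circ> g) (s x) = x" if "x \<in> X" for x
      using g sZ[OF that] by (force simp: homeomorphism_def)
  qed (rule sm)
qed

section \<open>Weak compactness of Borel probability measures\<close>

definition borel_probs :: "'a::metric_space set \<Rightarrow> 'a measure set" where
  "borel_probs X = {\<mu>. sets \<mu> = sets (restrict_space borel X) \<and> prob_space \<mu>}"

definition weak_limit :: "'a::metric_space set \<Rightarrow> (nat \<Rightarrow> 'a measure) \<Rightarrow> 'a measure \<Rightarrow> bool" where
  "weak_limit X \<mu> \<nu> \<longleftrightarrow>
     (\<forall>f :: 'a \<Rightarrow> real. continuous_on X f \<longrightarrow> (\<lambda>m. \<integral>x. f x \<partial>\<mu> m) \<longlonglongrightarrow> (\<integral>x. f x \<partial>\<nu>))"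

lemma space_borel_probs: "\<mu> \<in> borel_probs X \<Longrightarrow> space \<mu> = X"
  using sets_eq_imp_space_eq[of \<mu> "restrict_space borel X"]
  by (simp add: borel_probs_def space_restrict_space)

lemma borel_probs_measurable:
  assumes "\<mu> \<in> borel_probs X" "continuous_on X f"
  shows "f \<in> borel_measurable \<mu>"
  using borel_measurable_continuous_on_restrict[OF assms(2)] assms(1)
  by (simp add: borel_probs_def cong: measurable_cong_sets)

lemma borel_probs_integrable:
  fixes f :: "'a::metric_space \<Rightarrow> real"
  assumes X: "compact X" and \<mu>: "\<mu> \<in> borel_probs X" and f: "continuous_on X f"
  shows "integrable \<mu> f"
proof -
  interpret prob_space \<mu> using \<mu> by (simp add: borel_probs_def)
  obtain B where "\<And>x. x \<in> X \<Longrightarrow> norm (f x) \<le> B"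
    using compact_imp_bounded[OF compact_continuous_image[OF f X]]
    by (auto simp: bounded_iff)
  then show ?thesis
    using borel_probs_measurable[OF \<mu> f] space_borel_probs[OF \<mu>]
    by (intro integrable_const_bound[where B = B]) auto
qed

text \<open>The laws of the code \<open>s\<close> live on the bounded set \<open>K\<close>, so they
  are tight and a subsequence converges weakly on the line. The limit \<open>M\<close> may charge
  points of \<open>K\<close> that code no point of \<open>X\<close>; it can still be brought back to
  \<open>X\<close> because the decoder \<open>\<pi>\<close> is defined and continuous on all of
  \<open>K\<close>.\<close>

theorem borel_probs_weakly_compact:
  fixes X :: "'a::metric_space set"
  assumes X: "compact X" "X \<noteq> {}" and \<mu>: "\<And>m. \<mu> m \<in> borel_probs X"
  obtains r \<nu> where "strict_mono (r :: nat \<Rightarrow> nat)" "\<nu> \<in> borel_probs X" "weak_limit X (\<mu> \<circ> r) \<nu>"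
proof -
  obtain s :: "'a \<Rightarrow> real" and K \<pi> where
    s: "s \<in> borel_measurable (restrict_space borel X)" and K: "compact K" and
    \<pi>: "continuous_on K \<pi>" "\<pi> ` K \<subseteq> X" and
    sK: "\<And>x. x \<in> X \<Longrightarrow> s x \<in> K" and \<pi>s: "\<And>x. x \<in> X \<Longrightarrow> \<pi> (s x) = x"
    using compact_borel_real_section[OF X] by blast
  have K_ne: "K \<noteq> {}" using sK X(2) by blast
  have cK: "closed K" using K by (rule compact_imp_closed)
  have s\<mu>[measurable]: "s \<in> borel_measurable (\<mu> m)" for m
    using s \<mu>[of m] by (simp add: borel_probs_def cong: measurable_cong_sets)
  have P: "prob_space (\<mu> m)" for m using \<mu>[of m] by (simp add: borel_probs_def)
  have sp: "space (\<mu> m) = X" for m using \<mu> by (rule space_borel_probs)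
  define \<Lambda> where "\<Lambda> m = distr (\<mu> m) borel s" for m
  have rd: "real_distribution (\<Lambda> m)" for m
    unfolding \<Lambda>_def using prob_space.real_distribution_distr[OF P s\<mu>] .
  obtain b where b: "\<And>t. t \<in> K \<Longrightarrow> \<bar>t\<bar> \<le> b" "0 < b"
    using compact_imp_bounded[OF K] by (auto simp: bounded_pos)
  \<comment> \<open>Tightness is formulated with intervals open on the left, so the left end is
    moved from \<open>- b\<close> to \<open>- b - 1\<close>.\<close>
  have "measure (\<Lambda> m) {- b - 1 <.. b} = 1" for m
  proof -
    have "s -` {- b - 1 <.. b} \<inter> space (\<mu> m) = space (\<mu> m)"
      using sK b(1) by (fastforce simp: sp)
    then show ?thesis
      using prob_space.prob_space[OF P[of m]] by (simp add: \<Lambda>_def measure_distr)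
  qed
  then have "tight \<Lambda>"
    unfolding tight_def using rd b(2)
    by (intro conjI allI impI exI[of _ "- b - 1"] exI[of _ b]) auto
  then obtain r M where r: "strict_mono r" and M: "real_distribution M"
    and w: "weak_conv_m (\<Lambda> \<circ> r) M"
    using tight_imp_convergent_subsubsequence[of \<Lambda> id] by (auto simp: strict_mono_def)
  interpret M: real_distribution M by fact
  have conv: "(\<lambda>m. \<integral>x. h (s x) \<partial>\<mu> (r m)) \<longlonglongrightarrow> (\<integral>t. h t \<partial>M)"
    if h: "continuous_on UNIV h" "\<And>t. \<bar>h t\<bar> \<le> B" for h :: "real \<Rightarrow> real" and B
  proof -
    have "weak_conv_m (\<lambda>m. \<Lambda> (r m)) M" using w by (simp add: o_def)
    then have "(\<lambda>m. \<integral>t. h t \<partial>\<Lambda> (r m)) \<longlonglongrightarrow> (\<integral>t. h t \<partial>M)"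
      using h rd M
      by (intro weak_conv_imp_integral_bdd_continuous_conv[where B = B])
         (auto simp: continuous_on_eq_continuous_at)
    moreover have "(\<integral>t. h t \<partial>\<Lambda> (r m)) = (\<integral>x. h (s x) \<partial>\<mu> (r m))" for m
      unfolding \<Lambda>_def
      using h(1) by (intro integral_distr) (auto intro: borel_measurable_continuous_onI)
    ultimately show ?thesis by simp
  qed
  have "AE t in M. t \<in> K"
  proof -
    \<comment> \<open>A bounded continuous function that vanishes exactly on \<open>K\<close>: its
      integral against every code law is 0, hence also in the limit.\<close>
    define h where "h t = min 1 (infdist t K)" for t
    have h: "continuous_on UNIV h" "\<And>t. \<bar>h t\<bar> \<le> 1" "\<And>t. 0 \<le> h t"
      unfolding h_def by (intro continuous_intros) (auto simp: infdist_nonneg min_def)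
    have [measurable]: "h \<in> borel_measurable borel"
      using h(1) by (rule borel_measurable_continuous_onI)
    have "(\<integral>x. h (s x) \<partial>\<mu> (r m)) = 0" for m
      using sK by (intro integral_eq_zero_AE AE_I2) (auto simp: sp h_def)
    then have "(\<integral>t. h t \<partial>M) = 0"
      using conv[OF h(1,2)] by (simp add: LIMSEQ_const_iff)
    moreover have "integrable M h"
      using h(2) by (intro M.integrable_const_bound[where B = 1]) auto
    ultimately have "AE t in M. h t = 0"
      using h(3) by (subst (asm) integral_nonneg_eq_0_iff_AE) auto
    moreover have "t \<in> K" if "h t = 0" for t
      using that by (subst in_closed_iff_infdist_zero[OF cK K_ne]) (simp add: h_def min_def split: if_splits)
    ultimately show ?thesis by (rule eventually_mono)
  qed
  have KM: "K \<in> sets M" using cK by (simp add: M.events_eq_borel)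
  define MK where "MK = restrict_space M K"
  have "emeasure M K = 1"
    using \<open>AE t in M. t \<in> K\<close> KM by (intro M.emeasure_eq_1_AE)
  then have PK: "prob_space MK"
    unfolding MK_def using KM by (intro prob_space_restrict_space)
  have spK: "space MK = K" by (simp add: MK_def space_restrict_space)
  have sMK: "sets MK = sets (restrict_space borel K)"
    unfolding MK_def by (intro sets_restrict_space_cong) simp
  have "\<pi> \<in> borel_measurable MK"
    using borel_measurable_continuous_on_restrict[OF \<pi>(1)] sMK
    by (simp cong: measurable_cong_sets)
  then have \<pi>m: "\<pi> \<in> measurable MK (restrict_space borel X)"
    using \<pi>(2) spK by (intro measurable_restrict_space2) auto
  define \<nu> where "\<nu> = distr MK (restrict_space borel X) \<pi>"
  have \<nu>: "\<nu> \<in> borel_probs X"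
    unfolding borel_probs_def \<nu>_def using prob_space.prob_space_distr[OF PK \<pi>m] by simp
  have "weak_limit X (\<mu> \<circ> r) \<nu>"
    unfolding weak_limit_def
  proof (intro allI impI)
    fix f :: "'a \<Rightarrow> real" assume f: "continuous_on X f"
    obtain B where B: "\<And>x. x \<in> X \<Longrightarrow> norm (f x) \<le> B" "0 < B"
      using compact_imp_bounded[OF compact_continuous_image[OF f X(1)]]
      by (auto simp: bounded_pos)
    have "continuous_on K (\<lambda>t. f (\<pi> t))"
      using continuous_on_compose2[OF f \<pi>] .
    \<comment> \<open>\<open>conv\<close> takes functions on the whole line, so
      \<open>f \<circ> \<pi>\<close> is extended from \<open>K\<close> by Tietze with the same
      bound. On codes the extension agrees with \<open>f\<close>, as
      \<open>\<pi> (s x) = x\<close>.\<close>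
    then obtain h where h: "continuous_on UNIV h" "\<And>t. t \<in> K \<Longrightarrow> h t = f (\<pi> t)"
      "\<And>t. norm (h t) \<le> B"
      using Tietze[of K "\<lambda>t. f (\<pi> t)" UNIV B] B \<pi>(2) cK
      by (auto simp: image_subset_iff)
    have [measurable]: "h \<in> borel_measurable borel"
      using h(1) by (rule borel_measurable_continuous_onI)
    have "(\<integral>x. h (s x) \<partial>\<mu> (r m)) = (\<integral>x. f x \<partial>\<mu> (r m))" for m
      using sK h(2) \<pi>s by (intro Bochner_Integration.integral_cong) (auto simp: sp)
    then have c: "(\<lambda>m. \<integral>x. f x \<partial>(\<mu> \<circ> r) m) \<longlonglongrightarrow> (\<integral>t. h t \<partial>M)"
      using conv[OF h(1), of B] h(3) by simp
    have "(\<integral>x. f x \<partial>\<nu>) = (\<integral>t. f (\<pi> t) \<partial>MK)"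
      unfolding \<nu>_def using \<pi>m borel_measurable_continuous_on_restrict[OF f]
      by (intro integral_distr)
    also have "\<dots> = (\<integral>t. h t \<partial>MK)"
      using h(2) by (intro Bochner_Integration.integral_cong) (auto simp: spK)
    also have "\<dots> = (\<integral>t. indicator K t *\<^sub>R h t \<partial>M)"
      unfolding MK_def using KM by (intro integral_restrict_space) simp
    also have "\<dots> = (\<integral>t. h t \<partial>M)"
      using \<open>AE t in M. t \<in> K\<close> KM
      by (intro integral_cong_AE) (auto elim!: eventually_mono simp: M.events_eq_borel)
    finally show "(\<lambda>m. \<integral>x. f x \<partial>(\<mu> \<circ> r) m) \<longlonglongrightarrow> (\<integral>x. f x \<partial>\<nu>)" using c by simp
  qed
  then show ?thesis using that r \<nu> by blast
qed

text \<open>The bumps are 1 on \<open>F\<close> and eventually 0 at each point off \<open>F\<close>,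
  where \<open>infdist x F\<close> is positive because \<open>F\<close> is closed. For an empty
  \<open>F\<close> the default \<open>infdist x F = 0\<close> would make every bump constantly
  1.\<close>

lemma integral_bumps_tendsto:
  fixes F X :: "'a::metric_space set"
  assumes \<mu>: "\<mu> \<in> borel_probs X" and F: "closed F" "F \<noteq> {}" "F \<subseteq> X"
  shows "(\<lambda>j. \<integral>x. max 0 (1 - real j * infdist x F) \<partial>\<mu>) \<longlonglongrightarrow> measure \<mu> F"
proof -
  interpret prob_space \<mu> using \<mu> by (simp add: borel_probs_def)
  have FM: "F \<in> sets \<mu>"
    using \<mu> F(1,3) by (auto simp: borel_probs_def sets_restrict_space intro!: image_eqI[of _ _ F])
  have "(\<lambda>j. \<integral>x. max 0 (1 - real j * infdist x F) \<partial>\<mu>) \<longlonglongrightarrow> (\<integral>x. indicator F x \<partial>\<mu>)"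
  proof (rule integral_dominated_convergence[where w = "\<lambda>_. 1"])
    show "(\<lambda>x. max 0 (1 - real j * infdist x F)) \<in> borel_measurable \<mu>" for j
      by (intro borel_probs_measurable[OF \<mu>] continuous_intros)
    show "AE x in \<mu>. (\<lambda>j. max 0 (1 - real j * infdist x F)) \<longlonglongrightarrow> indicator F x"
    proof (rule AE_I2)
      fix x
      show "(\<lambda>j. max 0 (1 - real j * infdist x F)) \<longlonglongrightarrow> indicator F x"
      proof (cases "x \<in> F")
        case False
        then have pos: "0 < infdist x F"
          using in_closed_iff_infdist_zero[OF F(1,2)] infdist_nonneg[of x F]
          by (metis order_le_less)
        obtain n where n: "1 < real n * infdist x F"
          using reals_Archimedean3[OF pos] by blast
        have "\<forall>\<^sub>F j in sequentially. max 0 (1 - real j * infdist x F) = indicator F x"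
          using eventually_ge_at_top[of n]
        proof eventually_elim
          case (elim j)
          then have "real n * infdist x F \<le> real j * infdist x F"
            using pos by (intro mult_right_mono) auto
          then show ?case using n False by simp
        qed
        then show ?thesis by (rule tendsto_eventually)
      qed simp
    qed
    show "AE x in \<mu>. norm (max 0 (1 - real j * infdist x F)) \<le> 1" for j
      by (rule AE_I2) (simp add: infdist_nonneg)
  qed (use FM in auto)
  then show ?thesis using FM by simp
qed

text \<open>Finite intersections of complements of basis sets form a countable generator of the
  Borel sets of \<open>X\<close> that is stable under intersection, and bump functions recover the
  measure of each. Countability matters later: it permits the weighted series of squares in
  \<open>ergodic_in_face\<close>.\<close>

lemma measure_determining_sequence:
  fixes X :: "'a::metric_space set"
  assumes X: "compact X" "X \<noteq> {}"
  obtains g :: "nat \<Rightarrow> 'a \<Rightarrow> real"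
  where "\<And>k. continuous_on X (g k)" "\<And>k x. 0 \<le> g k x" "\<And>k x. g k x \<le> 1"
    "\<And>\<mu> \<nu>. \<mu> \<in> borel_probs X \<Longrightarrow> \<nu> \<in> borel_probs X
      \<Longrightarrow> (\<And>k. (\<integral>x. g k x \<partial>\<mu>) = (\<integral>x. g k x \<partial>\<nu>)) \<Longrightarrow> \<mu> = \<nu>"
proof -
  obtain U :: "nat \<Rightarrow> 'a set" where U: "\<And>k. open (U k)"
    "\<And>x e. x \<in> X \<Longrightarrow> 0 < e \<Longrightarrow> \<exists>k. x \<in> U k \<and> U k \<subseteq> ball x e"
    using compact_countable_base[OF X] by blast
  \<comment> \<open>Indexing by lists turns intersection into appending, makes \<open>F []\<close>
    equal to \<open>X\<close>, and lets \<open>from_nat\<close> enumerate the pairs of a steepness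
    and a set.\<close>
  define F where "F ks = X - (\<Union>k\<in>set ks. U k)" for ks
  have cF: "closed (F ks)" for ks
    unfolding F_def using X(1) U(1) by (intro closed_Diff compact_imp_closed open_UN) auto
  have FX: "F ks \<subseteq> X" for ks by (auto simp: F_def)
  define E where "E = range F"
  have gen: "sets (restrict_space borel X) = sigma_sets X E"
  proof
    have compl: "X - F ks \<in> sigma_sets X E" for ks
      by (intro sigma_sets.Compl sigma_sets.Basic) (simp add: E_def)
    have XA: "X \<inter> A \<in> sigma_sets X E" if "A \<in> sigma_sets UNIV {S. open S}" for A
      using that
    proof induction
      case (Basic S)
      have "x \<in> (\<Union>k\<in>{k. X \<inter> U k \<subseteq> S}. X - F [k])" if x: "x \<in> X" "x \<in> S" for x
      proof -
        obtain e where e: "0 < e" "ball x e \<subseteq> S"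
          using Basic x by (auto simp: open_contains_ball)
        obtain k where "x \<in> U k" "U k \<subseteq> ball x e"
          using U(2)[OF x(1) e(1)] by blast
        then show ?thesis
          using x e(2) by (intro UN_I[of k]) (auto simp: F_def)
      qed
      moreover have "X - F [k] = X \<inter> U k" for k by (auto simp: F_def)
      ultimately have "X \<inter> S = (\<Union>k\<in>{k. X \<inter> U k \<subseteq> S}. X - F [k])" by blast
      also have "\<dots> \<in> sigma_sets X E"
        by (intro sigma_sets_UNION) (auto simp: compl)
      finally show ?case .
    next
      case Empty
      then show ?case by (simp add: sigma_sets.Empty)
    next
      case (Compl A)
      have "X \<inter> (UNIV - A) = X - X \<inter> A" by auto
      then show ?case using sigma_sets.Compl[OF Compl.IH] by simp
    next
      case (Union A)
      have "X \<inter> (\<Union>i. A i) = (\<Union>i. X \<inter> A i)" by auto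
      then show ?case using sigma_sets.Union[OF Union.IH] by simp
    qed
    show "sets (restrict_space borel X) \<subseteq> sigma_sets X E"
      using XA by (auto simp: sets_restrict_space borel_def)
    have "E \<subseteq> sets (restrict_space borel X)"
      using cF FX by (auto simp: E_def sets_restrict_space intro!: image_eqI[OF _ borel_closed])
    then show "sigma_sets X E \<subseteq> sets (restrict_space borel X)"
      using sets.sigma_sets_subset[of E "restrict_space borel X"]
      by (simp add: space_restrict_space)
  qed
  define bump where "bump p x = max 0 (1 - real (fst p) * infdist x (F (snd p)))" for p and x :: 'a
  define g where "g k = bump (from_nat k)" for k
  show ?thesis
  proof
    show "continuous_on X (g k)" for k
      unfolding g_def bump_def by (intro continuous_intros)
    show "0 \<le> g k x" "g k x \<le> 1" for k x
      by (auto simp: g_def bump_def infdist_nonneg)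
    fix \<mu> \<nu> assume \<mu>: "\<mu> \<in> borel_probs X" and \<nu>: "\<nu> \<in> borel_probs X"
      and eq: "\<And>k. (\<integral>x. g k x \<partial>\<mu>) = (\<integral>x. g k x \<partial>\<nu>)"
    interpret \<mu>: prob_space \<mu> using \<mu> by (simp add: borel_probs_def)
    interpret \<nu>: prob_space \<nu> using \<nu> by (simp add: borel_probs_def)
    have eqb: "(\<integral>x. max 0 (1 - real j * infdist x (F ks)) \<partial>\<mu>)
        = (\<integral>x. max 0 (1 - real j * infdist x (F ks)) \<partial>\<nu>)" for j ks
      using eq[of "to_nat (j, ks)"] by (simp add: g_def bump_def)
    have "measure \<mu> (F ks) = measure \<nu> (F ks)" for ks
    proof (cases "F ks = {}")
      case False
      show ?thesis
        using integral_bumps_tendsto[OF \<mu> cF False FX] integral_bumps_tendsto[OF \<nu> cF False FX]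
        unfolding eqb by (rule LIMSEQ_unique)
    qed simp
    then have eqF: "emeasure \<mu> (F ks) = emeasure \<nu> (F ks)" for ks
      by (simp add: \<mu>.emeasure_eq_measure \<nu>.emeasure_eq_measure)
    have FF: "F ks \<inter> F ls = F (ks @ ls)" for ks ls by (auto simp: F_def)
    show "\<mu> = \<nu>"
    proof (rule measure_eqI_generator_eq[where \<Omega> = X and E = E and A = "\<lambda>_. X"])
      show "Int_stable E" by (auto simp: Int_stable_def E_def FF)
      show "E \<subseteq> Pow X" using FX by (auto simp: E_def)
      show "sets \<mu> = sigma_sets X E" "sets \<nu> = sigma_sets X E"
        using \<mu> \<nu> gen by (simp_all add: borel_probs_def)
      have "F [] = X" by (simp add: F_def)
      then show "range (\<lambda>_. X) \<subseteq> E" by (auto simp: E_def)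
    qed (use eqF in \<open>auto simp: E_def\<close>)
  qed
qed

lemma borel_probs_eqI:
  fixes X :: "'a::metric_space set"
  assumes X: "compact X" and \<mu>: "\<mu> \<in> borel_probs X" and \<nu>: "\<nu> \<in> borel_probs X"
    and eq: "\<And>f :: 'a \<Rightarrow> real. continuous_on X f \<Longrightarrow> (\<integral>x. f x \<partial>\<mu>) = (\<integral>x. f x \<partial>\<nu>)"
  shows "\<mu> = \<nu>"
proof -
  have "X \<noteq> {}"
    using prob_space.not_empty[of \<mu>] space_borel_probs[OF \<mu>] \<mu> by (simp add: borel_probs_def)
  then show ?thesis
    using measure_determining_sequence[OF X] \<mu> \<nu> eq by metis
qed

section \<open>Invariant measures and ergodicity\<close>

definition invariant_probs :: "'a::metric_space set \<Rightarrow> ('a \<Rightarrow> 'a) \<Rightarrow> 'a measure set" where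
  "invariant_probs X T = {\<mu> \<in> borel_probs X. distr \<mu> \<mu> T = \<mu>}"

lemma borel_probs_measurable_self:
  assumes "\<mu> \<in> borel_probs X" "continuous_on X T" "T ` X \<subseteq> X"
  shows "T \<in> measurable \<mu> \<mu>"
proof -
  have "T \<in> measurable \<mu> (restrict_space borel X)"
    using assms borel_probs_measurable[OF assms(1,2)] space_borel_probs[OF assms(1)]
    by (intro measurable_restrict_space2) auto
  then show ?thesis using assms(1) by (simp add: borel_probs_def cong: measurable_cong_sets)
qed

lemma integral_invariant_probs:
  fixes f :: "'a::metric_space \<Rightarrow> real"
  assumes \<mu>: "\<mu> \<in> invariant_probs X T" and T: "continuous_on X T" "T ` X \<subseteq> X"
    and f: "continuous_on X f"
  shows "(\<integral>x. f (T x) \<partial>\<mu>) = (\<integral>x. f x \<partial>\<mu>)"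
proof -
  have \<mu>': "\<mu> \<in> borel_probs X" "distr \<mu> \<mu> T = \<mu>" using \<mu> by (auto simp: invariant_probs_def)
  have "(\<integral>x. f x \<partial>distr \<mu> \<mu> T) = (\<integral>x. f (T x) \<partial>\<mu>)"
    by (intro integral_distr borel_probs_measurable_self[OF \<mu>'(1) T] borel_probs_measurable[OF \<mu>'(1) f])
  then show ?thesis using \<mu>'(2) by simp
qed

lemma invariant_probsI:
  fixes X :: "'a::metric_space set"
  assumes X: "compact X" and T: "continuous_on X T" "T ` X \<subseteq> X" and \<mu>: "\<mu> \<in> borel_probs X"
    and eq: "\<And>f :: 'a \<Rightarrow> real. continuous_on X f \<Longrightarrow> (\<integral>x. f (T x) \<partial>\<mu>) = (\<integral>x. f x \<partial>\<mu>)"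
  shows "\<mu> \<in> invariant_probs X T"
proof -
  have Tm: "T \<in> measurable \<mu> \<mu>" using \<mu> T by (rule borel_probs_measurable_self)
  have P: "prob_space \<mu>" "sets \<mu> = sets (restrict_space borel X)"
    using \<mu> by (auto simp: borel_probs_def)
  have "distr \<mu> \<mu> T = \<mu>"
  proof (rule borel_probs_eqI[OF X])
    show "distr \<mu> \<mu> T \<in> borel_probs X"
      using prob_space.prob_space_distr[OF P(1) Tm] P(2) by (simp add: borel_probs_def)
    show "(\<integral>x. f x \<partial>distr \<mu> \<mu> T) = (\<integral>x. f x \<partial>\<mu>)" if f: "continuous_on X f" for f :: "'a \<Rightarrow> real"
      using integral_distr[OF Tm borel_probs_measurable[OF \<mu> f]] eq[OF f] by simp
  qed (rule \<mu>)
  then show ?thesis using \<mu> by (simp add: invariant_probs_def)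
qed

lemma invariant_probs_weak_limit:
  fixes X :: "'a::metric_space set"
  assumes X: "compact X" and T: "continuous_on X T" "T ` X \<subseteq> X"
    and \<mu>: "\<And>m. \<mu> m \<in> invariant_probs X T" and \<nu>: "\<nu> \<in> borel_probs X" "weak_limit X \<mu> \<nu>"
  shows "\<nu> \<in> invariant_probs X T"
proof (rule invariant_probsI[OF X T \<nu>(1)])
  fix f :: "'a \<Rightarrow> real" assume f: "continuous_on X f"
  have fT: "continuous_on X (\<lambda>x. f (T x))" using continuous_on_compose2[OF f T] .
  have "(\<lambda>m. \<integral>x. f (T x) \<partial>\<mu> m) \<longlonglongrightarrow> (\<integral>x. f (T x) \<partial>\<nu>)"
    using \<nu>(2) fT by (simp add: weak_limit_def)
  moreover have "(\<lambda>m. \<integral>x. f (T x) \<partial>\<mu> m) \<longlonglongrightarrow> (\<integral>x. f x \<partial>\<nu>)"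
    using \<nu>(2) f integral_invariant_probs[OF \<mu> T f] by (simp add: weak_limit_def)
  ultimately show "(\<integral>x. f (T x) \<partial>\<nu>) = (\<integral>x. f x \<partial>\<nu>)" by (rule LIMSEQ_unique)
qed

lemma invariant_probs_weakly_compact:
  fixes X :: "'a::metric_space set"
  assumes X: "compact X" and T: "continuous_on X T" "T ` X \<subseteq> X"
    and \<mu>: "\<And>m. \<mu> m \<in> invariant_probs X T"
  obtains r \<nu> where "strict_mono (r :: nat \<Rightarrow> nat)" "\<nu> \<in> invariant_probs X T"
    "weak_limit X (\<mu> \<circ> r) \<nu>"
proof -
  have \<mu>': "\<mu> m \<in> borel_probs X" for m using \<mu> by (simp add: invariant_probs_def)
  have "X \<noteq> {}"
    using prob_space.not_empty[of "\<mu> 0"] space_borel_probs[OF \<mu>'] \<mu>'[of 0]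
    by (simp add: borel_probs_def)
  then obtain r \<nu> where r: "strict_mono (r :: nat \<Rightarrow> nat)" "\<nu> \<in> borel_probs X"
    "weak_limit X (\<mu> \<circ> r) \<nu>"
    by (rule borel_probs_weakly_compact[OF X _ \<mu>'])
  have "\<nu> \<in> invariant_probs X T"
    by (rule invariant_probs_weak_limit[OF X T _ r(2,3)]) (simp add: \<mu>)
  with r(1) show ?thesis using r(3) by (rule that)
qed

text \<open>Shifting the orbit by one step changes an orbit sum only by its two end terms, so the
  averages of \<open>f \<circ> T\<close> and of \<open>f\<close> have the same limit. The conclusion
  keeps the convergence of the orbit averages, since the choice of \<open>y\<close> is what makes
  \<open>\<nu>\<close> maximizing later.\<close>

theorem krylov_bogoliubov:
  fixes X :: "'a::metric_space set"
  assumes X: "compact X" and T: "continuous_on X T" "T ` X \<subseteq> X" and y: "y \<in> X"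
  obtains r \<nu> where "strict_mono (r :: nat \<Rightarrow> nat)" "\<nu> \<in> invariant_probs X T"
    "\<And>f :: 'a \<Rightarrow> real. continuous_on X f \<Longrightarrow>
      (\<lambda>m. (\<Sum>i\<le>r m. f ((T ^^ i) y)) / Suc (r m)) \<longlonglongrightarrow> (\<integral>x. f x \<partial>\<nu>)"
proof -
  have orb: "(T ^^ i) y \<in> X" for i
    by (induction i) (use y T(2) in auto)
  define \<mu> where "\<mu> m = distr (measure_pmf (pmf_of_set {..m})) (restrict_space borel X) (\<lambda>i. (T ^^ i) y)"
    for m :: nat
  have meas: "(\<lambda>i. (T ^^ i) y) \<in> measurable (measure_pmf p) (restrict_space borel X)" for p
    using orb by (auto simp: space_restrict_space)
  have \<mu>: "\<mu> m \<in> borel_probs X" for m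
    unfolding borel_probs_def \<mu>_def
    using prob_space.prob_space_distr[OF prob_space_measure_pmf meas] by simp
  have int: "(\<integral>x. f x \<partial>\<mu> m) = (\<Sum>i\<le>m. f ((T ^^ i) y)) / Suc m"
    if f: "continuous_on X f" for f :: "'a \<Rightarrow> real" and m
  proof -
    have "(\<integral>x. f x \<partial>\<mu> m) = (\<integral>i. f ((T ^^ i) y) \<partial>measure_pmf (pmf_of_set {..m}))"
      unfolding \<mu>_def by (intro integral_distr meas borel_measurable_continuous_on_restrict f)
    also have "\<dots> = (\<Sum>i\<le>m. f ((T ^^ i) y)) / Suc m"
      by (subst integral_pmf_of_set) auto
    finally show ?thesis .
  qed
  obtain r \<nu> where r: "strict_mono (r :: nat \<Rightarrow> nat)" and \<nu>: "\<nu> \<in> borel_probs X"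
    and w: "weak_limit X (\<mu> \<circ> r) \<nu>"
    by (rule borel_probs_weakly_compact[OF X _ \<mu>]) (use y in auto)
  have lim: "(\<lambda>m. (\<Sum>i\<le>r m. f ((T ^^ i) y)) / Suc (r m)) \<longlonglongrightarrow> (\<integral>x. f x \<partial>\<nu>)"
    if "continuous_on X f" for f :: "'a \<Rightarrow> real"
  proof -
    have "(\<lambda>m. \<integral>x. f x \<partial>(\<mu> \<circ> r) m) \<longlonglongrightarrow> (\<integral>x. f x \<partial>\<nu>)"
      using w that unfolding weak_limit_def by blast
    then show ?thesis using int[OF that] by simp
  qed
  have "\<nu> \<in> invariant_probs X T"
  proof (rule invariant_probsI[OF X T \<nu>])
    fix f :: "'a \<Rightarrow> real" assume f: "continuous_on X f"
    obtain B where B: "\<And>x. x \<in> X \<Longrightarrow> \<bar>f x\<bar> \<le> B"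
      using compact_imp_bounded[OF compact_continuous_image[OF f X]]
      by (auto simp: bounded_iff)
    define a where "a i = f ((T ^^ i) y)" for i
    have a: "\<bar>a i\<bar> \<le> B" for i using B orb by (simp add: a_def)
    have fT: "continuous_on X (\<lambda>x. f (T x))" using continuous_on_compose2[OF f T] .
    have "(\<lambda>m. (\<Sum>i\<le>r m. a (Suc i)) / Suc (r m) - (\<Sum>i\<le>r m. a i) / Suc (r m))
        \<longlonglongrightarrow> (\<integral>x. f (T x) \<partial>\<nu>) - (\<integral>x. f x \<partial>\<nu>)"
      using tendsto_diff[OF lim[OF fT] lim[OF f]] by (simp add: a_def)
    moreover have "(\<lambda>m. (\<Sum>i\<le>r m. a (Suc i)) / Suc (r m) - (\<Sum>i\<le>r m. a i) / Suc (r m))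
        \<longlonglongrightarrow> 0"
    proof (rule Lim_null_comparison)
      show "\<forall>\<^sub>F m in sequentially. norm ((\<Sum>i\<le>r m. a (Suc i)) / Suc (r m)
          - (\<Sum>i\<le>r m. a i) / Suc (r m)) \<le> 2 * B * inverse (real (Suc m))"
      proof (rule always_eventually, rule allI)
        fix m
        have "(\<Sum>i\<le>r m. a (Suc i)) - (\<Sum>i\<le>r m. a i) = (\<Sum>i\<le>r m. a (Suc i) - a i)"
          by (simp add: sum_subtractf)
        also have "\<dots> = a (Suc (r m)) - a 0"
          using sum_lessThan_telescope[of a "Suc (r m)"] by (simp add: lessThan_Suc_atMost)
        finally have "\<bar>(\<Sum>i\<le>r m. a (Suc i)) - (\<Sum>i\<le>r m. a i)\<bar> \<le> 2 * B"
          using a[of "Suc (r m)"] a[of 0] by linarith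
        then have "norm ((\<Sum>i\<le>r m. a (Suc i)) / Suc (r m) - (\<Sum>i\<le>r m. a i) / Suc (r m))
            \<le> 2 * B * inverse (real (Suc (r m)))"
          by (simp add: diff_divide_distrib[symmetric] divide_inverse abs_mult
              left_diff_distrib[symmetric] mult_right_mono del: of_nat_Suc)
        also have "\<dots> \<le> 2 * B * inverse (real (Suc m))"
          using seq_suble[OF r, of m] a[of 0] by (intro mult_left_mono le_imp_inverse_le) auto
        finally show "norm ((\<Sum>i\<le>r m. a (Suc i)) / Suc (r m)
          - (\<Sum>i\<le>r m. a i) / Suc (r m)) \<le> 2 * B * inverse (real (Suc m))" .
      qed
      show "(\<lambda>m. 2 * B * inverse (real (Suc m))) \<longlonglongrightarrow> 0"
        by (rule tendsto_mult_right_zero[OF LIMSEQ_inverse_real_of_nat])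
    qed
    ultimately have "(\<integral>x. f (T x) \<partial>\<nu>) - (\<integral>x. f x \<partial>\<nu>) = 0" by (rule LIMSEQ_unique)
    then show "(\<integral>x. f (T x) \<partial>\<nu>) = (\<integral>x. f x \<partial>\<nu>)" by simp
  qed
  with r show ?thesis using lim by (rule that)
qed

text \<open>The convex combination \<open>t \<mu> + (1 - t) \<mu>'\<close>, tested against functions
  with values in \<open>ennreal\<close>, so that it can be applied to deficits
  \<open>K - elog (F x)\<close> whose integrals may be infinite.\<close>

definition mixture :: "real \<Rightarrow> 'a measure \<Rightarrow> 'a measure \<Rightarrow> 'a measure \<Rightarrow> bool" where
  "mixture t \<mu> \<mu>' \<nu> \<longleftrightarrow> (\<forall>h \<in> borel_measurable \<nu>.
     (\<integral>\<^sup>+x. h x \<partial>\<nu>) = ennreal t * (\<integral>\<^sup>+x. h x \<partial>\<mu>) + ennreal (1 - t) * (\<integral>\<^sup>+x. h x \<partial>\<mu>'))"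

lemma mixture_swap: "mixture t \<mu> \<mu>' \<nu> \<Longrightarrow> mixture (1 - t) \<mu>' \<mu> \<nu>"
  by (simp add: mixture_def add.commute)

lemma integral_mixture:
  fixes f :: "'a::metric_space \<Rightarrow> real"
  assumes X: "compact X" and mix: "mixture t \<mu> \<mu>' \<nu>" and t: "0 \<le> t" "t \<le> 1"
    and P: "\<mu> \<in> borel_probs X" "\<mu>' \<in> borel_probs X" "\<nu> \<in> borel_probs X"
    and f: "continuous_on X f" "\<And>x. 0 \<le> f x"
  shows "(\<integral>x. f x \<partial>\<nu>) = t * (\<integral>x. f x \<partial>\<mu>) + (1 - t) * (\<integral>x. f x \<partial>\<mu>')"
proof -
  have nn: "(\<integral>\<^sup>+x. ennreal (f x) \<partial>\<kappa>) = ennreal (\<integral>x. f x \<partial>\<kappa>)" if "\<kappa> \<in> borel_probs X" for \<kappa>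
    using borel_probs_integrable[OF X that f(1)] f(2) by (intro nn_integral_eq_integral) auto
  have "(\<lambda>x. ennreal (f x)) \<in> borel_measurable \<nu>"
    using borel_probs_measurable[OF P(3) f(1)] by simp
  then have "ennreal (\<integral>x. f x \<partial>\<nu>)
      = ennreal t * ennreal (\<integral>x. f x \<partial>\<mu>) + ennreal (1 - t) * ennreal (\<integral>x. f x \<partial>\<mu>')"
    using mix P by (simp add: mixture_def nn[symmetric])
  also have "\<dots> = ennreal (t * (\<integral>x. f x \<partial>\<mu>) + (1 - t) * (\<integral>x. f x \<partial>\<mu>'))"
    using t f(2) by (simp add: ennreal_mult ennreal_plus integral_nonneg_AE)
  finally show ?thesis
    using t f(2) by (subst (asm) ennreal_inj) (auto intro!: add_nonneg_nonneg mult_nonneg_nonneg integral_nonneg_AE)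
qed

lemma invariant_probs_uniform_measure:
  assumes \<nu>: "\<nu> \<in> invariant_probs X T" and T: "continuous_on X T" "T ` X \<subseteq> X"
    and B: "B \<in> sets \<nu>" "T -` B \<inter> space \<nu> = B" "emeasure \<nu> B \<noteq> 0"
  shows "uniform_measure \<nu> B \<in> invariant_probs X T"
proof -
  have \<nu>': "\<nu> \<in> borel_probs X" "distr \<nu> \<nu> T = \<nu>" using \<nu> by (auto simp: invariant_probs_def)
  interpret prob_space \<nu> using \<nu>'(1) by (simp add: borel_probs_def)
  have Tm: "T \<in> measurable \<nu> \<nu>" using \<nu>'(1) T by (rule borel_probs_measurable_self)
  have "distr (uniform_measure \<nu> B) (uniform_measure \<nu> B) T = uniform_measure \<nu> B"
  proof (rule measure_eqI)
    fix A assume "A \<in> sets (distr (uniform_measure \<nu> B) (uniform_measure \<nu> B) T)"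
    then have A: "A \<in> sets \<nu>" by simp
    have TA: "T -` A \<inter> space \<nu> \<in> sets \<nu>" using Tm A by (rule measurable_sets)
    have "emeasure (distr (uniform_measure \<nu> B) (uniform_measure \<nu> B) T) A
        = emeasure (uniform_measure \<nu> B) (T -` A \<inter> space \<nu>)"
      using A Tm by (subst emeasure_distr) (auto cong: measurable_cong_sets)
    also have "\<dots> = emeasure \<nu> (B \<inter> (T -` A \<inter> space \<nu>)) / emeasure \<nu> B"
      using TA B(1) by simp
    \<comment> \<open>Strict invariance of \<open>B\<close> lets conditioning commute with the
      preimage.\<close>
    also have "B \<inter> (T -` A \<inter> space \<nu>) = T -` (B \<inter> A) \<inter> space \<nu>"
      using B(2) by auto
    also have "emeasure \<nu> (T -` (B \<inter> A) \<inter> space \<nu>) = emeasure (distr \<nu> \<nu> T) (B \<inter> A)"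
      using A B(1) Tm by (subst emeasure_distr) auto
    also have "\<dots> = emeasure \<nu> (B \<inter> A)" using \<nu>'(2) by simp
    finally show "emeasure (distr (uniform_measure \<nu> B) (uniform_measure \<nu> B) T) A
        = emeasure (uniform_measure \<nu> B) A"
      using A B(1) by simp
  qed simp
  moreover have "prob_space (uniform_measure \<nu> B)"
    using B(3) by (intro prob_space_uniform_measure) auto
  ultimately show ?thesis
    using \<nu>'(1) by (simp add: invariant_probs_def borel_probs_def)
qed

text \<open>Law of total probability. For an invariant \<open>B\<close> of intermediate measure this
  is the splitting that a nonergodic measure admits.\<close>

lemma mixture_uniform_measure:
  assumes "prob_space \<nu>" and B: "B \<in> sets \<nu>" "0 < measure \<nu> B" "measure \<nu> B < 1"
  shows "mixture (measure \<nu> B) (uniform_measure \<nu> B) (uniform_measure \<nu> (space \<nu> - B)) \<nu>"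
  unfolding mixture_def
proof
  interpret prob_space \<nu> by fact
  fix h :: "_ \<Rightarrow> ennreal" assume h[measurable]: "h \<in> borel_measurable \<nu>"
  note B(1)[measurable]
  have part: "ennreal (measure \<nu> C) * (\<integral>\<^sup>+x. h x \<partial>uniform_measure \<nu> C) = (\<integral>\<^sup>+x. h x * indicator C x \<partial>\<nu>)"
    if [measurable]: "C \<in> sets \<nu>" and C: "0 < measure \<nu> C" for C
  proof -
    have "(\<integral>\<^sup>+x. h x \<partial>uniform_measure \<nu> C)
        = (\<integral>\<^sup>+x. h x * indicator C x \<partial>\<nu>) / ennreal (measure \<nu> C)"
      by (subst nn_integral_uniform_measure) (auto simp: emeasure_eq_measure)
    then show ?thesis
      using C by (simp add: ennreal_times_divide mult.commute[of "ennreal _"] mult_divide_eq_ennreal)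
  qed
  have "(\<integral>\<^sup>+x. h x \<partial>\<nu>) = (\<integral>\<^sup>+x. h x * indicator B x + h x * indicator (space \<nu> - B) x \<partial>\<nu>)"
    by (intro nn_integral_cong) (auto split: split_indicator)
  also have "\<dots> = (\<integral>\<^sup>+x. h x * indicator B x \<partial>\<nu>) + (\<integral>\<^sup>+x. h x * indicator (space \<nu> - B) x \<partial>\<nu>)"
    by (intro nn_integral_add) auto
  also have "\<dots> = ennreal (measure \<nu> B) * (\<integral>\<^sup>+x. h x \<partial>uniform_measure \<nu> B)
      + ennreal (measure \<nu> (space \<nu> - B)) * (\<integral>\<^sup>+x. h x \<partial>uniform_measure \<nu> (space \<nu> - B))"
    using part[of B] part[of "space \<nu> - B"] B by (simp add: prob_compl)
  finally show "(\<integral>\<^sup>+x. h x \<partial>\<nu>) = ennreal (measure \<nu> B) * (\<integral>\<^sup>+x. h x \<partial>uniform_measure \<nu> B)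
      + ennreal (1 - measure \<nu> B) * (\<integral>\<^sup>+x. h x \<partial>uniform_measure \<nu> (space \<nu> - B))"
    using B(1) by (simp add: prob_compl)
qed

text \<open>Suppose the maximizer \<open>\<nu>\<close> of \<open>Q\<close> splits into its
  conditional measures on an invariant set \<open>B\<close> and on the complement. Both stay in the
  face \<open>M\<close>, so by strict convexity of \<open>Q\<close> they coincide; but they give
  \<open>B\<close> the masses 1 and 0.\<close>

theorem ergodic_in_face:
  fixes X :: "'a::metric_space set"
  assumes X: "compact X" and T: "continuous_on X T" "T ` X \<subseteq> X"
    and M: "M \<subseteq> invariant_probs X T" "M \<noteq> {}"
    and closed: "\<And>\<mu> \<nu>. (\<And>m. \<mu> m \<in> M) \<Longrightarrow> \<nu> \<in> invariant_probs X T \<Longrightarrow> weak_limit X \<mu> \<nu> \<Longrightarrow> \<nu> \<in> M"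
    and face: "\<And>\<mu> \<mu>' \<nu> t. \<nu> \<in> M \<Longrightarrow> \<mu> \<in> invariant_probs X T \<Longrightarrow> \<mu>' \<in> invariant_probs X T
      \<Longrightarrow> 0 < t \<Longrightarrow> t < 1 \<Longrightarrow> mixture t \<mu> \<mu>' \<nu> \<Longrightarrow> \<mu> \<in> M"
  shows "\<exists>\<nu>\<in>M. \<forall>B\<in>sets \<nu>. T -` B \<inter> space \<nu> = B \<longrightarrow> measure \<nu> B = 0 \<or> measure \<nu> B = 1"
proof -
  have MB: "\<mu> \<in> borel_probs X" if "\<mu> \<in> M" for \<mu>
    using that M(1) by (auto simp: invariant_probs_def)
  obtain \<mu>0 where "\<mu>0 \<in> borel_probs X" using M(2) MB by blast
  then have "X \<noteq> {}"
    using space_borel_probs[of \<mu>0 X] prob_space.not_empty[of \<mu>0] by (simp add: borel_probs_def)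
  then obtain g :: "nat \<Rightarrow> 'a \<Rightarrow> real" where g: "\<And>k. continuous_on X (g k)" "\<And>k x. 0 \<le> g k x"
    "\<And>k x. g k x \<le> 1" and det: "\<And>\<mu> \<nu>. \<mu> \<in> borel_probs X \<Longrightarrow> \<nu> \<in> borel_probs X
      \<Longrightarrow> (\<And>k. (\<integral>x. g k x \<partial>\<mu>) = (\<integral>x. g k x \<partial>\<nu>)) \<Longrightarrow> \<mu> = \<nu>"
    using measure_determining_sequence[OF X] by metis
  define G where "G k \<mu> = (\<integral>x. g k x \<partial>\<mu>)" for k \<mu>
  have G: "0 \<le> G k \<mu>" "G k \<mu> \<le> 1" if "\<mu> \<in> borel_probs X" for k \<mu>
  proof -
    interpret prob_space \<mu> using that by (simp add: borel_probs_def)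
    show "0 \<le> G k \<mu>" unfolding G_def using g(2) by (simp add: integral_nonneg_AE)
    have "G k \<mu> \<le> (\<integral>x. 1 \<partial>\<mu>)"
      unfolding G_def using borel_probs_integrable[OF X that g(1)] g(3) by (intro integral_mono) auto
    then show "G k \<mu> \<le> 1" by (simp add: prob_space)
  qed
  \<comment> \<open>The squares give strict convexity in the integrals \<open>G k\<close>, which
    determine the measure. The summable weights dominate the terms uniformly in the measure, so
    \<open>Q\<close> is weakly continuous by Tannery's theorem.\<close>
  define q where "q k \<mu> = (1/2)^k * (G k \<mu>)^2" for k \<mu>
  define Q where "Q \<mu> = (\<Sum>k. q k \<mu>)" for \<mu>
  have q: "0 \<le> q k \<mu>" "q k \<mu> \<le> (1/2)^k" if "\<mu> \<in> borel_probs X" for k \<mu>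
    using G[OF that, of k] by (auto simp: q_def power_le_one intro!: mult_left_le)
  have gs: "summable (\<lambda>k. (1/2::real)^k)" by simp
  have qs: "summable (\<lambda>k. q k \<mu>)" if "\<mu> \<in> borel_probs X" for \<mu>
    using q[OF that] by (intro summable_comparison_test'[OF gs, of 0]) auto
  have Q2: "Q \<mu> \<le> (\<Sum>k. (1/2::real)^k)" if "\<mu> \<in> borel_probs X" for \<mu>
    unfolding Q_def using q[OF that] qs[OF that] gs by (intro suminf_le) auto
  then have bdd: "bdd_above (Q ` M)" using MB by (auto simp: bdd_above_def)
  define S where "S = (SUP \<mu>\<in>M. Q \<mu>)"
  have QS: "Q \<mu> \<le> S" if "\<mu> \<in> M" for \<mu>
    unfolding S_def using bdd that by (rule cSUP_upper2[OF _ _ order_refl])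
  have "\<exists>\<mu>\<in>M. S - inverse (Suc m) < Q \<mu>" for m
    using less_cSUP_iff[OF M(2) bdd, of "S - inverse (Suc m)"] by (simp add: S_def)
  then obtain \<mu> where \<mu>: "\<And>m. \<mu> m \<in> M" "\<And>m. S - inverse (Suc m) < Q (\<mu> m)" by metis
  have \<mu>I: "\<mu> m \<in> invariant_probs X T" for m using \<mu>(1) M(1) by auto
  obtain r \<nu> where r: "strict_mono r" and \<nu>: "\<nu> \<in> invariant_probs X T"
    and w: "weak_limit X (\<mu> \<circ> r) \<nu>"
    by (rule invariant_probs_weakly_compact[OF X T \<mu>I])
  have \<nu>M: "\<nu> \<in> M" using closed[of "\<mu> \<circ> r" \<nu>] \<mu>(1) \<nu> w by simp
  have "(\<lambda>m. Q ((\<mu> \<circ> r) m)) \<longlonglongrightarrow> Q \<nu>"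
  proof -
    have lim: "(\<lambda>m. q k ((\<mu> \<circ> r) m)) \<longlonglongrightarrow> q k \<nu>" for k
      using w g(1) unfolding q_def G_def weak_limit_def by (intro tendsto_intros) auto
    have bound: "\<forall>\<^sub>F (k, m) in at_top \<times>\<^sub>F sequentially. norm (q k ((\<mu> \<circ> r) m)) \<le> (1/2)^k"
      using q[OF MB] \<mu>(1) by (intro always_eventually) auto
    show ?thesis
      unfolding Q_def using tannerys_theorem[OF lim bound gs] by simp
  qed
  moreover have "(\<lambda>m. S - inverse (Suc m)) \<longlonglongrightarrow> S - 0"
    by (intro tendsto_intros LIMSEQ_inverse_real_of_nat)
  then have "(\<lambda>m. S - inverse (Suc (r m))) \<longlonglongrightarrow> S"
    using LIMSEQ_subseq_LIMSEQ[OF _ r, of "\<lambda>m. S - inverse (Suc m)"] by (simp add: o_def)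
  ultimately have SQ: "S \<le> Q \<nu>"
    using \<mu>(2) by (intro LIMSEQ_le[of "\<lambda>m. S - inverse (Suc (r m))" S "\<lambda>m. Q ((\<mu> \<circ> r) m)"])
      (auto intro: less_imp_le)
  have \<nu>B: "\<nu> \<in> borel_probs X" using MB[OF \<nu>M] .
  interpret prob_space \<nu> using \<nu>B by (simp add: borel_probs_def)
  have sp: "space \<nu> = X" using \<nu>B by (rule space_borel_probs)
  show ?thesis
  proof (intro bexI[OF _ \<nu>M] ballI impI, rule ccontr)
    fix B assume B: "B \<in> sets \<nu>" "T -` B \<inter> space \<nu> = B"
      and "\<not> (measure \<nu> B = 0 \<or> measure \<nu> B = 1)"
    then have p: "0 < measure \<nu> B" "measure \<nu> B < 1"
      using prob_le_1[of B] measure_nonneg[of \<nu> B] by linarith+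
    define t where "t = measure \<nu> B"
    define \<nu>1 where "\<nu>1 = uniform_measure \<nu> B"
    define \<nu>2 where "\<nu>2 = uniform_measure \<nu> (space \<nu> - B)"
    have e: "emeasure \<nu> B \<noteq> 0" "emeasure \<nu> (space \<nu> - B) \<noteq> 0"
      using p B(1) by (auto simp: emeasure_eq_measure prob_compl)
    have i1: "\<nu>1 \<in> invariant_probs X T"
      unfolding \<nu>1_def using \<nu> T B e(1) by (rule invariant_probs_uniform_measure)
    have "T -` (space \<nu> - B) \<inter> space \<nu> = space \<nu> - B"
      using B(2) T(2) unfolding sp by blast
    then have i2: "\<nu>2 \<in> invariant_probs X T"
      unfolding \<nu>2_def using \<nu> T B(1) e(2) by (intro invariant_probs_uniform_measure) auto
    have mix: "mixture t \<nu>1 \<nu>2 \<nu>"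
      unfolding t_def \<nu>1_def \<nu>2_def using prob_space_axioms B(1) p by (rule mixture_uniform_measure)
    have t: "0 < t" "t < 1" using p by (auto simp: t_def)
    have m1: "\<nu>1 \<in> M" using face[OF \<nu>M i1 i2 t mix] .
    have m2: "\<nu>2 \<in> M" using face[OF \<nu>M i2 i1 _ _ mixture_swap[OF mix]] t by simp
    note b = MB[OF m1] MB[OF m2]
    have Gmix: "G k \<nu> = t * G k \<nu>1 + (1 - t) * G k \<nu>2" for k
      unfolding G_def using t by (intro integral_mixture[OF X mix _ _ b \<nu>B g(1,2)]) auto
    define d where "d k = (1/2)^k * (G k \<nu>1 - G k \<nu>2)^2" for k
    \<comment> \<open>The exact convexity gap of the square: \<open>t x^2 + (1 - t) y^2 - (t x + (1
      - t) y)^2 = t (1 - t) (x - y)^2\<close>. Its sum over \<open>k\<close> is at most 0 by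
      maximality of \<open>\<nu>\<close>, which forces every \<open>d k\<close> to be 0.\<close>
    have dk: "t * (1 - t) * d k = t * q k \<nu>1 + (1 - t) * q k \<nu>2 - q k \<nu>" for k
      unfolding d_def q_def Gmix by (simp add: power2_eq_square algebra_simps)
    have "(\<lambda>k. t * q k \<nu>1 + (1 - t) * q k \<nu>2 - q k \<nu>)
        sums (t * Q \<nu>1 + (1 - t) * Q \<nu>2 - Q \<nu>)"
      unfolding Q_def by (intro sums_add sums_diff sums_mult summable_sums qs b \<nu>B)
    then have ds: "(\<lambda>k. t * (1 - t) * d k) sums (t * Q \<nu>1 + (1 - t) * Q \<nu>2 - Q \<nu>)"
      by (simp add: dk)
    have "t * Q \<nu>1 \<le> t * S" "(1 - t) * Q \<nu>2 \<le> (1 - t) * S"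
      using QS[OF m1] QS[OF m2] t by (auto intro!: mult_left_mono)
    then have le0: "t * Q \<nu>1 + (1 - t) * Q \<nu>2 - Q \<nu> \<le> 0"
      using SQ by (simp add: algebra_simps)
    have "G k \<nu>1 = G k \<nu>2" for k
    proof -
      have "(\<Sum>k\<in>{k}. t * (1 - t) * d k) \<le> (\<Sum>k. t * (1 - t) * d k)"
        using ds t by (intro sum_le_suminf) (auto simp: sums_iff d_def)
      then have "t * (1 - t) * d k \<le> 0" using ds le0 by (simp add: sums_iff)
      moreover have "0 \<le> d k" by (simp add: d_def)
      ultimately have "d k = 0"
        using t by (simp add: mult_le_0_iff)
      then show ?thesis by (simp add: d_def)
    qed
    then have eq: "\<nu>1 = \<nu>2" using det[OF b] by (simp add: G_def)
    have "measure \<nu>1 B = 1"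
      unfolding \<nu>1_def using B(1) p e(1) by (subst measure_uniform_measure) auto
    moreover have "measure \<nu>2 B = 0"
      unfolding \<nu>2_def using B(1) p e(2) by (subst measure_uniform_measure) (auto simp: Diff_Int_distrib2)
    ultimately show False unfolding eq by linarith
  qed
qed

section \<open>Subadditivity and matrix norms\<close>

text \<open>With \<open>m = q n + r\<close> and \<open>r < n\<close>, the value \<open>u m\<close>
  is at most \<open>q\<close> copies of \<open>u n\<close> plus \<open>u r\<close>. Only upper
  bounds are used, so the terms and the infimum may be \<open>- \<infinity>\<close>; a real
  \<open>c\<close> above the infimum stands in for it in the estimates.\<close>

lemma fekete_ereal:
  fixes u :: "nat \<Rightarrow> ereal"
  assumes sub: "\<And>m n. u (m + n) \<le> u m + u n" and fin: "\<And>n. u n < \<infinity>"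
  shows "(\<lambda>n. ereal (1 / real n) * u n) \<longlonglongrightarrow> (INF n\<in>{1..}. ereal (1 / real n) * u n)"
proof (rule order_tendstoI)
  fix c assume "c < (INF n\<in>{1..}. ereal (1 / real n) * u n)"
  then have "c < ereal (1 / real n) * u n" if "n \<ge> 1" for n
    using that by (elim less_le_trans, intro INF_lower) simp
  then show "\<forall>\<^sub>F n in sequentially. c < ereal (1 / real n) * u n"
    by (rule eventually_mono[OF eventually_ge_at_top[of 1]])
next
  fix c' assume "(INF n\<in>{1..}. ereal (1 / real n) * u n) < c'"
  then obtain c where c: "(INF n\<in>{1..}. ereal (1 / real n) * u n) < ereal c" "ereal c < c'"
    using ereal_dense2 by blast
  then obtain n where n: "n \<ge> 1" "ereal (1 / real n) * u n < ereal c"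
    by (auto simp: INF_less_iff)
  have un: "u n \<le> ereal (real n * c)"
    using n by (cases "u n") (auto simp: field_simps)
  have "\<exists>B. 0 \<le> B \<and> u r \<le> ereal B" for r
  proof (cases "u r")
    case (real x)
    then show ?thesis by (intro exI[of _ "max 0 x"]) simp
  qed (use fin[of r] in auto)
  then obtain b where b: "\<And>r. 0 \<le> b r" "\<And>r. u r \<le> ereal (b r)" by metis
  define B where "B = (\<Sum>r<n. b r)"
  have B: "u r \<le> ereal B" if "r < n" for r
    using b(2)[of r] member_le_sum[of r "{..<n}" b] b(1) that
    by (simp add: B_def order_trans)
  have uq: "u (q * n + r) \<le> ereal (real (q * n) * c + B)" if "r < n" for q r
  proof (induction q)
    case 0
    then show ?case using B[OF that] by simp
  next
    case (Suc q)
    have "u (Suc q * n + r) = u (n + (q * n + r))" by (simp add: algebra_simps)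
    also have "\<dots> \<le> u n + u (q * n + r)" by (rule sub)
    also have "\<dots> \<le> ereal (real n * c) + ereal (real (q * n) * c + B)"
      by (intro add_mono un Suc)
    finally show ?case by (simp add: algebra_simps)
  qed
  \<comment> \<open>Replacing \<open>m div n * n\<close> by \<open>m\<close> in front of
    \<open>c\<close> costs at most \<open>n\<close> times \<open>\<bar>c\<bar>\<close>, whatever the
    sign of \<open>c\<close>.\<close>
  define D where "D = real n * \<bar>c\<bar> + B"
  have um: "ereal (1 / real m) * u m \<le> ereal (c + D * inverse (real m))" if "m \<ge> 1" for m
  proof -
    have r: "m mod n < n" using n by simp
    have "real (m div n * n) * c = real m * c - real (m mod n) * c"
      by (simp add: left_diff_distrib[symmetric] minus_mod_eq_div_mult[symmetric] of_nat_diff)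
    moreover have "\<bar>real (m mod n) * c\<bar> \<le> real n * \<bar>c\<bar>"
      using r by (simp add: abs_mult mult_right_mono)
    ultimately have "real (m div n * n) * c + B \<le> real m * c + D"
      unfolding D_def by linarith
    then have "u m \<le> ereal (real m * c + D)"
      using uq[OF r, of "m div n"] by (simp add: order_trans)
    then have "ereal (1 / real m) * u m \<le> ereal (1 / real m) * ereal (real m * c + D)"
      by (intro ereal_mult_left_mono) auto
    also have "\<dots> = ereal (c + D * inverse (real m))"
      using that by (simp add: field_simps)
    finally show ?thesis .
  qed
  have "(\<lambda>m. c + D * inverse (real m)) \<longlonglongrightarrow> c + D * 0"
    by (intro tendsto_intros lim_inverse_n)
  then have "(\<lambda>m. ereal (c + D * inverse (real m))) \<longlonglongrightarrow> ereal c" by simp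
  then have "\<forall>\<^sub>F m in sequentially. ereal (c + D * inverse (real m)) < c'"
    using c(2) by (rule order_tendstoD)
  then show "\<forall>\<^sub>F m in sequentially. ereal (1 / real m) * u m < c'"
    using eventually_ge_at_top[of 1] by eventually_elim (use um in \<open>auto intro: le_less_trans\<close>)
qed

section \<open>The logarithm with value minus infinity at 0\<close>

lemma elog_mono: "0 \<le> s \<Longrightarrow> s \<le> t \<Longrightarrow> elog s \<le> elog t"
  by (auto simp: elog_def)

lemma elog_less_PInfty: "elog t < \<infinity>"
  by (simp add: elog_def)

lemma elog_mult: "0 \<le> s \<Longrightarrow> 0 \<le> t \<Longrightarrow> elog (s * t) = elog s + elog t"
  by (auto simp: elog_def ln_mult)

lemma elog_le_iff: "0 \<le> t \<Longrightarrow> elog t \<le> ereal c \<longleftrightarrow> t \<le> exp c"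
  by (auto simp: elog_def ln_ge_iff ln_le_cancel_iff[symmetric, of t "exp c"] simp del: ln_le_cancel_iff)

lemma le_elog_iff: "0 \<le> t \<Longrightarrow> ereal c \<le> elog t \<longleftrightarrow> exp c \<le> t"
  by (auto simp: elog_def ln_ge_iff not_le)

lemma elog_eq_MInfty_iff: "elog t = - \<infinity> \<longleftrightarrow> t = 0"
  by (simp add: elog_def)

lemma elog_root: "0 < n \<Longrightarrow> 0 \<le> t \<Longrightarrow> elog (root n t) = ereal (1 / real n) * elog t"
  by (auto simp: elog_def ln_root)

text \<open>The subadditive estimates give convergence of logarithms in \<open>ereal\<close>, but
  \<open>joint_spectral_radius\<close> is a limit of reals. Exponentiating handles a finite limit;
  the limit \<open>- \<infinity>\<close> corresponds to \<open>R = 0\<close>.\<close>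

lemma elog_tendsto_imp_tendsto:
  fixes s :: "nat \<Rightarrow> real"
  assumes s: "\<And>n. n \<ge> 1 \<Longrightarrow> 0 \<le> s n" and lim: "(\<lambda>n. elog (s n)) \<longlonglongrightarrow> l" and l: "l < \<infinity>"
  obtains R where "0 \<le> R" "elog R = l" "s \<longlonglongrightarrow> R"
proof (cases l)
  case (real c)
  have "\<forall>\<^sub>F n in sequentially. elog (s n) > - \<infinity>"
    using lim by (rule order_tendstoD) (simp add: real)
  then have ev: "\<forall>\<^sub>F n in sequentially. s n = exp (real_of_ereal (elog (s n)))"
    using eventually_ge_at_top[of 1]
  proof eventually_elim
    case (elim n)
    then show ?case using s[of n] by (auto simp: elog_def split: if_splits)
  qed
  have "(\<lambda>n. real_of_ereal (elog (s n))) \<longlonglongrightarrow> c"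
    using lim_real_of_ereal[of "\<lambda>n. elog (s n)" c] lim real by simp
  then have "(\<lambda>n. exp (real_of_ereal (elog (s n)))) \<longlonglongrightarrow> exp c" by (rule tendsto_exp)
  then have "s \<longlonglongrightarrow> exp c"
    using ev by (simp cong: tendsto_cong)
  moreover have "elog (exp c) = l" by (simp add: real elog_def)
  ultimately show ?thesis using that[of "exp c"] by simp
next
  case MInf
  have "s \<longlonglongrightarrow> 0"
  proof (rule order_tendstoI)
    fix e :: real assume e: "e < 0"
    show "\<forall>\<^sub>F n in sequentially. e < s n"
      using eventually_ge_at_top[of 1] by eventually_elim (use s e in force)
  next
    fix e :: real assume e: "0 < e"
    have "\<forall>\<^sub>F n in sequentially. elog (s n) < ereal (ln e)"
      using lim by (rule order_tendstoD) (simp add: MInf)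
    then show "\<forall>\<^sub>F n in sequentially. s n < e"
      using eventually_ge_at_top[of 1]
    proof eventually_elim
      case (elim n)
      then have "\<not> ereal (ln e) \<le> elog (s n)" by simp
      then show ?case using le_elog_iff[OF s[of n], of "ln e"] elim e by simp
    qed
  qed
  then show ?thesis using that[of 0] MInf by (simp add: elog_def)
qed (use l in simp)

section \<open>Submultiplicative norms on complex matrices\<close>

lemma submult_norm_nonneg: "submult_norm N \<Longrightarrow> 0 \<le> N A"
  by (simp add: submult_norm_def)

lemma submult_norm_eq_0_iff: "submult_norm N \<Longrightarrow> N A = 0 \<longleftrightarrow> A = 0"
  by (simp add: submult_norm_def)

lemma submult_norm_triangle: "submult_norm N \<Longrightarrow> N (A + B) \<le> N A + N B"
  by (simp add: submult_norm_def)

lemma submult_norm_mult: "submult_norm N \<Longrightarrow> N (A ** B) \<le> N A * N B"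
  by (simp add: submult_norm_def)

lemma submult_norm_scaleR:
  assumes "submult_norm N"
  shows "N (r *\<^sub>R A) = \<bar>r\<bar> * N A"
proof -
  have "(\<chi> i j. complex_of_real r * A $ i $ j) = r *\<^sub>R A"
    by (simp add: vec_eq_iff scaleR_conv_of_real[where 'a = complex])
  then show ?thesis
    using assms unfolding submult_norm_def by (metis norm_of_real)
qed

lemma submult_norm_le_norm:
  fixes N :: "complex^'d^'d \<Rightarrow> real"
  assumes N: "submult_norm N"
  obtains C where "0 < C" "\<And>A. N A \<le> C * norm A"
proof
  define C where "C = 1 + (\<Sum>b\<in>Basis. N b)"
  show "0 < C"
    using submult_norm_nonneg[OF N] by (simp add: C_def add_pos_nonneg sum_nonneg)
  fix A :: "complex^'d^'d"
  have N_sum: "N (\<Sum>b\<in>S. f b) \<le> (\<Sum>b\<in>S. N (f b))" if "finite S" for S and f :: "complex^'d^'d \<Rightarrow> _"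
    using that
  proof induction
    case empty
    then show ?case using submult_norm_eq_0_iff[OF N, of 0] by simp
  next
    case (insert b S)
    then show ?case using submult_norm_triangle[OF N, of "f b" "sum f S"] by simp
  qed
  have "N A = N (\<Sum>b\<in>Basis. (A \<bullet> b) *\<^sub>R b)" by (simp add: euclidean_representation)
  also have "\<dots> \<le> (\<Sum>b\<in>Basis. N ((A \<bullet> b) *\<^sub>R b))" by (rule N_sum) simp
  also have "\<dots> = (\<Sum>b\<in>Basis. \<bar>A \<bullet> b\<bar> * N b)" by (simp add: submult_norm_scaleR[OF N])
  also have "\<dots> \<le> (\<Sum>b\<in>Basis. norm A * N b)"
    by (intro sum_mono mult_right_mono Basis_le_norm submult_norm_nonneg[OF N])
  also have "\<dots> = norm A * (\<Sum>b\<in>Basis. N b)" by (simp add: sum_distrib_left)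
  also have "\<dots> \<le> C * norm A" by (simp add: C_def algebra_simps)
  finally show "N A \<le> C * norm A" .
qed

lemma submult_norm_continuous:
  fixes N :: "complex^'d^'d \<Rightarrow> real"
  assumes N: "submult_norm N"
  shows "continuous_on UNIV N"
proof -
  obtain C where C: "0 < C" "\<And>A. N A \<le> C * norm A"
    using submult_norm_le_norm[OF N] by blast
  have le: "N A - N B \<le> C * dist A B" for A B
    using submult_norm_triangle[OF N, of "A - B" B] C(2)[of "A - B"] by (simp add: dist_norm)
  have "C-lipschitz_on UNIV N"
  proof (rule lipschitz_onI)
    show "dist (N A) (N B) \<le> C * dist A B" for A B
      using le[of A B] le[of B A] by (simp add: dist_real_def dist_commute abs_le_iff)
  qed (use C in simp)
  then show ?thesis by (rule lipschitz_on_continuous_on)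
qed

text \<open>\<open>N\<close> is continuous, so it attains a positive minimum on the compact unit
  sphere; the inverse of this minimum is the constant, by homogeneity.\<close>

lemma norm_le_submult_norm:
  fixes N :: "complex^'d^'d \<Rightarrow> real"
  assumes N: "submult_norm N"
  obtains C where "0 < C" "\<And>A. norm A \<le> C * N A"
proof -
  have "sphere (0 :: complex^'d^'d) 1 \<noteq> {}" by simp
  then obtain A0 :: "complex^'d^'d" where A0: "A0 \<in> sphere 0 1" "\<And>A. A \<in> sphere 0 1 \<Longrightarrow> N A0 \<le> N A"
    using continuous_attains_inf[OF compact_sphere _ continuous_on_subset[OF submult_norm_continuous[OF N]]]
    by (metis subset_UNIV)
  have "A0 \<noteq> 0" using A0(1) by auto
  then have pos: "0 < N A0"
    using submult_norm_nonneg[OF N, of A0] submult_norm_eq_0_iff[OF N, of A0] by simp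
  have "norm A \<le> inverse (N A0) * N A" for A
  proof (cases "A = 0")
    case True
    then show ?thesis using pos submult_norm_nonneg[OF N] by simp
  next
    case False
    have "N A0 \<le> N (inverse (norm A) *\<^sub>R A)"
      using False by (intro A0(2)) simp
    also have "\<dots> = inverse (norm A) * N A" by (simp add: submult_norm_scaleR[OF N])
    finally show ?thesis using pos False by (simp add: field_simps)
  qed
  then show ?thesis using that[of "inverse (N A0)"] pos by simp
qed

text \<open>Allows the operator norm, in which the joint spectral radius is defined, to be exchanged
  for \<open>N\<close>: a constant factor disappears under \<open>n\<close>-th roots.\<close>

lemma submult_norm_equivalent:
  fixes N N' :: "complex^'d^'d \<Rightarrow> real"
  assumes N: "submult_norm N" and N': "submult_norm N'"
  obtains C where "1 \<le> C" "\<And>A. N A \<le> C * N' A"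
proof -
  obtain C where C: "0 < C" "\<And>A. N A \<le> C * norm A"
    using submult_norm_le_norm[OF N] by blast
  obtain D where D: "0 < D" "\<And>A :: complex^'d^'d. norm A \<le> D * N' A"
    using norm_le_submult_norm[OF N'] by blast
  have "N A \<le> max 1 (C * D) * N' A" for A
  proof -
    have "N A \<le> C * (D * N' A)"
      using C D by (meson mult_left_mono order_trans less_imp_le)
    also have "\<dots> \<le> max 1 (C * D) * N' A"
      using submult_norm_nonneg[OF N', of A] by (simp add: mult.assoc[symmetric] mult_right_mono)
    finally show ?thesis .
  qed
  then show ?thesis using that[of "max 1 (C * D)"] by simp
qed

lemma submult_norm_op_norm: "submult_norm (op_norm :: complex^'d^'d \<Rightarrow> real)"
proof -
  have bl: "bounded_linear ((*v) A)" for A :: "complex^'d^'d" by simp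
  have cmult: "(\<chi> i j. c * A $ i $ j) *v v = (\<chi> i. c * (A *v v) $ i)" for c v and A :: "complex^'d^'d"
    by (simp add: matrix_vector_mult_def vec_eq_iff sum_distrib_left mult.assoc)
  have norm_cmult: "norm (\<chi> i. c * v $ i) = cmod c * norm v" for c and v :: "complex^'d"
    by (simp add: norm_vec_def L2_set_def norm_mult power_mult_distrib sum_distrib_left[symmetric]
        real_sqrt_mult)
  have le: "op_norm (\<chi> i j. c * A $ i $ j) \<le> cmod c * op_norm A" for c and A :: "complex^'d^'d"
    unfolding op_norm_def
  proof (rule onorm_le)
    fix v
    have "norm ((\<chi> i j. c * A $ i $ j) *v v) = cmod c * norm (A *v v)"
      by (simp add: cmult norm_cmult)
    also have "\<dots> \<le> cmod c * (onorm ((*v) A) * norm v)"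
      by (intro mult_left_mono onorm[OF bl]) simp
    finally show "norm ((\<chi> i j. c * A $ i $ j) *v v) \<le> cmod c * onorm ((*v) A) * norm v"
      by (simp add: mult.assoc)
  qed
  show ?thesis
    unfolding submult_norm_def
  proof (intro conjI allI)
    fix A B :: "complex^'d^'d" and c :: complex
    have sum: "(*v) (A + B) = (\<lambda>v. A *v v + B *v v)"
      by (simp add: fun_eq_iff matrix_vector_mult_add_rdistrib)
    have comp: "(*v) (A ** B) = (*v) A \<circ> (*v) B"
      by (simp add: fun_eq_iff matrix_vector_mul_assoc)
    show "0 \<le> op_norm A" unfolding op_norm_def using bl by (rule onorm_pos_le)
    show "op_norm A = 0 \<longleftrightarrow> A = 0"
      unfolding op_norm_def onorm_eq_0[OF bl] by (simp add: matrix_eq)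
    show "op_norm (A + B) \<le> op_norm A + op_norm B"
      unfolding op_norm_def sum using bl bl by (rule onorm_triangle)
    show "op_norm (A ** B) \<le> op_norm A * op_norm B"
      unfolding op_norm_def comp using bl bl by (rule onorm_compose)
    show "op_norm (\<chi> i j. c * A $ i $ j) = cmod c * op_norm A"
    proof (rule antisym[OF le])
      show "cmod c * op_norm A \<le> op_norm (\<chi> i j. c * A $ i $ j)"
      proof (cases "c = 0")
        case True
        then show ?thesis using bl by (simp add: op_norm_def onorm_pos_le)
      next
        case False
        \<comment> \<open>The reverse inequality is \<open>le\<close> for the factor
          \<open>inverse c\<close>, applied to the scaled matrix.\<close>
        then have "(\<chi> i j. inverse c * (\<chi> i j. c * A $ i $ j) $ i $ j) = A"
          by (simp add: vec_eq_iff)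
        then have "op_norm A \<le> inverse (cmod c) * op_norm (\<chi> i j. c * A $ i $ j)"
          using le[of "inverse c" "\<chi> i j. c * A $ i $ j"] by (simp add: norm_inverse)
        then show ?thesis using False by (simp add: field_simps)
      qed
    qed
  qed
qed

section \<open>The joint spectral radius and extremal sequences\<close>

lemma elog_le_cancel: "0 \<le> s \<Longrightarrow> 0 \<le> t \<Longrightarrow> elog s \<le> elog t \<Longrightarrow> s \<le> t"
  by (auto simp: elog_def split: if_splits)

text \<open>A \<open>SUP\<close> of reals is meaningful only for bounded families. A real
  \<open>l\<close> provides that bound; if \<open>l\<close> is \<open>- \<infinity>\<close>, all
  values are 0.\<close>

lemma elog_cSUP_le:
  assumes "Y \<noteq> {}" and f: "\<And>x. x \<in> Y \<Longrightarrow> 0 \<le> f x" "\<And>x. x \<in> Y \<Longrightarrow> elog (f x) \<le> l"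
  shows "elog (SUP x\<in>Y. f x) \<le> l"
proof (cases l)
  case (real c)
  have b: "f x \<le> exp c" if "x \<in> Y" for x
    using f(2)[OF that] elog_le_iff[OF f(1)[OF that]] by (simp add: real)
  then have "(SUP x\<in>Y. f x) \<le> exp c"
    using assms(1) by (intro cSUP_least)
  moreover have "0 \<le> (SUP x\<in>Y. f x)"
  proof -
    obtain x where "x \<in> Y" using assms(1) by blast
    moreover have "bdd_above (f ` Y)" using b by (auto simp: bdd_above_def)
    ultimately show ?thesis using f(1) by (intro cSUP_upper2[of f Y x]) auto
  qed
  ultimately show ?thesis using elog_le_iff real by simp
next
  case MInf
  then have "f x = 0" if "x \<in> Y" for x
    using f(2)[OF that] by (simp add: elog_eq_MInfty_iff)
  then have "(SUP x\<in>Y. f x) = 0" using assms(1) by simp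
  then show ?thesis by (simp add: elog_def)
qed simp

lemma ereal_scale_add:
  assumes "x < \<infinity>" "0 < c"
  shows "ereal c * (ereal k + x) = ereal c * x + ereal (c * k)"
  using assms by (cases x) (auto simp: algebra_simps)

lemma ereal_scale_le_iff:
  assumes "n \<ge> 1"
  shows "ereal (1 / real n) * x \<le> y \<longleftrightarrow> x \<le> ereal (real n) * y"
  using assms by (cases x; cases y) (auto simp: field_simps)

lemma le_ereal_scale_iff:
  assumes "n \<ge> 1"
  shows "y \<le> ereal (1 / real n) * x \<longleftrightarrow> ereal (real n) * y \<le> x"
  using assms by (cases x; cases y) (auto simp: field_simps)

section \<open>The space of sequences, the shift and the cocycle\<close>

lemma compact_seq_space:
  fixes I :: "'i::metric_space set"
  assumes "compact I"
  shows "compact (seq_space I)"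
proof -
  have "seq_space I = PiE UNIV (\<lambda>_. I)" by (auto simp: seq_space_def)
  moreover have "compactin (product_topology (\<lambda>_. euclidean) UNIV) (PiE (UNIV :: nat set) (\<lambda>_. I))"
    unfolding compactin_PiE using assms by simp
  ultimately show ?thesis by (simp add: euclidean_product_topology)
qed

lemma shift_funpow: "(shift ^^ m) x k = x (m + k)"
  by (induction m arbitrary: k) (simp_all add: shift_def)

lemma continuous_on_shift: "continuous_on S (shift :: (nat \<Rightarrow> 'i::metric_space) \<Rightarrow> _)"
  unfolding shift_def
  by (intro continuous_on_coordinatewise_then_product continuous_on_subset[OF continuous_on_product_coordinates]) simp

lemma shift_seq_space: "shift ` seq_space I \<subseteq> seq_space I"
  by (auto simp: seq_space_def shift_def)

lemma funpow_shift_seq_space: "x \<in> seq_space I \<Longrightarrow> (shift ^^ m) x \<in> seq_space I"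
  by (simp add: seq_space_def shift_funpow)

lemma continuous_on_matrix_mult:
  fixes f g :: "'a::topological_space \<Rightarrow> complex^'d^'d"
  assumes "continuous_on S f" "continuous_on S g"
  shows "continuous_on S (\<lambda>x. f x ** g x)"
  unfolding matrix_matrix_mult_def
  by (intro continuous_on_vec_lambda continuous_on_sum continuous_on_mult continuous_on_component assms)

lemma cocycle_add: "cocycle a x (m + n) = cocycle a ((shift ^^ m) x) n ** cocycle a x m"
  by (induction n) (simp_all add: shift_funpow matrix_mul_assoc)

lemma cocycle_cong: "(\<And>k. k < n \<Longrightarrow> x k = y k) \<Longrightarrow> cocycle a x n = cocycle a y n"
  by (induction n) simp_all

text \<open>\<open>foldr\<close> puts the head of a word leftmost, \<open>cocycle\<close> the latest
  entry. A word thus corresponds to a sequence that lists its letters backwards, and in the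
  induction the new head becomes the entry at position \<open>length w\<close>.\<close>

lemma foldr_words_eq_cocycles:
  assumes "I \<noteq> {}"
  shows "(\<lambda>w. foldr (**) w (mat 1)) ` {w. length w = n \<and> set w \<subseteq> a ` I}
    = (\<lambda>x. cocycle a x n) ` seq_space I"
proof (intro equalityI image_subsetI)
  fix w assume "w \<in> {w. length w = n \<and> set w \<subseteq> a ` I}"
  moreover have "\<exists>x\<in>seq_space I. cocycle a x (length w) = foldr (**) w (mat 1)" if "set w \<subseteq> a ` I"
    using that
  proof (induction w)
    case Nil
    obtain i where "i \<in> I" using assms by blast
    then show ?case by (intro bexI[of _ "\<lambda>_. i"]) (auto simp: seq_space_def)
  next
    case (Cons b w)
    then obtain x i where x: "x \<in> seq_space I" "cocycle a x (length w) = foldr (**) w (mat 1)"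
      and i: "i \<in> I" "b = a i" by auto
    define y where "y = x(length w := i)"
    have "cocycle a y (length w) = cocycle a x (length w)"
      by (rule cocycle_cong) (simp add: y_def)
    moreover have "y (length w) = i" "y \<in> seq_space I"
      using x(1) i(1) by (auto simp: y_def seq_space_def)
    ultimately show ?case
      using x i by (intro bexI[of _ y]) auto
  qed
  ultimately show "foldr (**) w (mat 1) \<in> (\<lambda>x. cocycle a x n) ` seq_space I"
    by force
next
  fix x assume x: "x \<in> seq_space I"
  have "\<exists>w. length w = n \<and> set w \<subseteq> a ` I \<and> foldr (**) w (mat 1) = cocycle a x n"
  proof (induction n)
    case (Suc n)
    then obtain w where "length w = n" "set w \<subseteq> a ` I" "foldr (**) w (mat 1) = cocycle a x n"
      by blast
    then show ?case using x by (intro exI[of _ "a (x n) # w"]) (auto simp: seq_space_def)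
  qed simp
  then show "cocycle a x n \<in> (\<lambda>w. foldr (**) w (mat 1)) ` {w. length w = n \<and> set w \<subseteq> a ` I}"
    by force
qed

locale indexed_cocycle =
  fixes I :: "'i::metric_space set" and a :: "'i \<Rightarrow> complex^'d^'d"
    and N :: "complex^'d^'d \<Rightarrow> real"
  assumes compact_I: "compact I" and I_nonempty: "I \<noteq> {}"
    and continuous_a: "continuous_on I a" and submult: "submult_norm N"
begin

definition growth :: "nat \<Rightarrow> ereal" where
  "growth n = (SUP x\<in>seq_space I. elog (N (cocycle a x n)))"

lemmas compact_X = compact_seq_space[OF compact_I]

lemma X_nonempty: "seq_space I \<noteq> {}"
  using I_nonempty by (auto simp: seq_space_def)

lemma continuous_on_cocycle: "continuous_on (seq_space I) (\<lambda>x. cocycle a x n)"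
proof (induction n)
  case (Suc n)
  have "continuous_on (seq_space I) (\<lambda>x. a (x n))"
    by (rule continuous_on_compose2[OF continuous_a])
      (auto intro: continuous_on_subset[OF continuous_on_product_coordinates] simp: seq_space_def)
  then show ?case using Suc by (simp add: continuous_on_matrix_mult)
qed simp

lemma continuous_on_norm_cocycle:
  assumes "submult_norm N'"
  shows "continuous_on (seq_space I) (\<lambda>x. N' (cocycle a x n))"
  by (rule continuous_on_compose2[OF submult_norm_continuous[OF assms] continuous_on_cocycle]) simp

lemma norm_cocycle_bounded:
  assumes "submult_norm N'"
  shows "\<exists>B\<ge>1. \<forall>x\<in>seq_space I. N' (cocycle a x n) \<le> B"
proof -
  obtain b where b: "\<forall>t\<in>(\<lambda>x. N' (cocycle a x n)) ` seq_space I. norm t \<le> b"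
    using compact_imp_bounded[OF compact_continuous_image[OF continuous_on_norm_cocycle[OF assms] compact_X]]
    unfolding bounded_iff by blast
  have "N' (cocycle a x n) \<le> max 1 b" if "x \<in> seq_space I" for x
    using bspec[OF b imageI[OF that]] by (simp add: abs_le_iff le_max_iff_disj)
  then show ?thesis by (intro exI[of _ "max 1 b"]) simp
qed

lemma elog_cocycle_bounded: "\<exists>K\<ge>0. \<forall>x\<in>seq_space I. elog (N (cocycle a x n)) \<le> ereal K"
proof -
  obtain B where B: "B \<ge> 1" "\<And>x. x \<in> seq_space I \<Longrightarrow> N (cocycle a x n) \<le> B"
    using norm_cocycle_bounded[OF submult] by blast
  then show ?thesis
    by (intro exI[of _ "ln B"]) (auto simp: elog_le_iff submult_norm_nonneg[OF submult])
qed

lemma elog_cocycle_add: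
  "elog (N (cocycle a x (m + n)))
     \<le> elog (N (cocycle a x m)) + elog (N (cocycle a ((shift ^^ m) x) n))"
proof -
  have "elog (N (cocycle a x (m + n)))
      \<le> elog (N (cocycle a ((shift ^^ m) x) n) * N (cocycle a x m))"
    unfolding cocycle_add by (intro elog_mono submult_norm_mult submult_norm_nonneg submult)
  then show ?thesis
    by (simp add: elog_mult submult_norm_nonneg[OF submult] add.commute)
qed

lemma elog_cocycle_le_growth: "x \<in> seq_space I \<Longrightarrow> elog (N (cocycle a x n)) \<le> growth n"
  unfolding growth_def by (rule SUP_upper)

lemma growth_finite: "growth n < \<infinity>"
proof -
  obtain K where "\<forall>x\<in>seq_space I. elog (N (cocycle a x n)) \<le> ereal K"
    using elog_cocycle_bounded by blast
  then have "growth n \<le> ereal K" unfolding growth_def by (intro SUP_least) auto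
  then show ?thesis by (rule le_less_trans) simp
qed

lemma growth_add: "growth (m + n) \<le> growth m + growth n"
  unfolding growth_def[of "m + n"]
proof (rule SUP_least)
  fix x assume x: "x \<in> seq_space I"
  show "elog (N (cocycle a x (m + n))) \<le> growth m + growth n"
    using x by (intro order_trans[OF elog_cocycle_add[of x m n]] add_mono elog_cocycle_le_growth
        funpow_shift_seq_space)
qed

text \<open>The Fekete limit for \<open>N\<close> itself. \<open>joint_spectral_radius_eq\<close>
  identifies it with the \<open>elog\<close> of the radius, after which the operator norm no longer
  appears.\<close>

definition log_jsr :: ereal where
  "log_jsr = (INF n\<in>{1..}. ereal (1 / real n) * growth n)"

lemma growth_tendsto: "(\<lambda>n. ereal (1 / real n) * growth n) \<longlonglongrightarrow> log_jsr"
  unfolding log_jsr_def using growth_add growth_finite by (rule fekete_ereal)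

lemma log_jsr_le: "n \<ge> 1 \<Longrightarrow> log_jsr \<le> ereal (1 / real n) * growth n"
  unfolding log_jsr_def by (rule INF_lower) simp

lemma log_jsr_finite: "log_jsr < \<infinity>"
proof -
  have "log_jsr \<le> ereal (1 / real 1) * growth 1" by (rule log_jsr_le) simp
  also have "\<dots> < \<infinity>" using growth_finite[of 1] by (simp add: one_ereal_def[symmetric])
  finally show ?thesis .
qed

text \<open>Exchanging \<open>N\<close> for the operator norm changes logarithms by at most a
  constant, negligible after division by \<open>n\<close>, so the logarithms of the suprema
  \<open>S n\<close> are squeezed to the Fekete limit. \<open>elog_tendsto_imp_tendsto\<close> turns
  this into convergence of \<open>S\<close>, which gives the value of \<open>lim\<close>.\<close>

lemma joint_spectral_radius_eq:
  "0 \<le> joint_spectral_radius (a ` I)" "elog (joint_spectral_radius (a ` I)) = log_jsr"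
proof -
  define S where "S n = (SUP w \<in> {w. length w = n \<and> set w \<subseteq> a ` I}. root n (op_norm (foldr (**) w (mat 1))))"
    for n
  have S: "S n = (SUP x\<in>seq_space I. root n (op_norm (cocycle a x n)))" for n
    unfolding S_def
    using arg_cong[OF foldr_words_eq_cocycles[OF I_nonempty, of n a],
        of "\<lambda>Y. Sup ((\<lambda>A. root n (op_norm A)) ` Y)"]
    by (simp only: image_image)
  note op = submult_norm_op_norm[where 'd = 'd]
  have op_nn: "0 \<le> op_norm A" for A :: "complex^'d^'d" by (rule submult_norm_nonneg[OF op])
  obtain C1 where C1: "1 \<le> C1" "\<And>A. N A \<le> C1 * op_norm A"
    by (rule submult_norm_equivalent[OF submult op]) (rule that)
  obtain C2 where C2: "1 \<le> C2" "\<And>A. op_norm A \<le> C2 * N A"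
    by (rule submult_norm_equivalent[OF op submult]) (rule that)
  have S_upper: "root n (op_norm (cocycle a x n)) \<le> S n" if x: "x \<in> seq_space I" and n: "n \<ge> 1" for x n
  proof -
    obtain B where "\<And>x. x \<in> seq_space I \<Longrightarrow> op_norm (cocycle a x n) \<le> B"
      using norm_cocycle_bounded[OF op] by blast
    then have "bdd_above ((\<lambda>x. root n (op_norm (cocycle a x n))) ` seq_space I)"
      using n by (auto simp: bdd_above_def intro!: exI[of _ "root n B"])
    then show ?thesis unfolding S using x by (rule cSUP_upper2[OF _ _ order_refl])
  qed
  have S_nn: "0 \<le> S n" if "n \<ge> 1" for n
  proof -
    obtain x where "x \<in> seq_space I" using X_nonempty by blast
    then show ?thesis using S_upper[of x n] that op_nn by (meson order_trans real_root_ge_zero)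
  qed
  have split: "elog (C * t) = ereal (ln C) + elog t" if "1 \<le> C" "0 \<le> t" for C t
    using that by (subst elog_mult) (auto simp: elog_def)
  have up: "elog (S n) \<le> ereal (1 / real n) * growth n + ereal (1 / real n * ln C2)" if n: "n \<ge> 1" for n
    unfolding S
  proof (rule elog_cSUP_le[OF X_nonempty])
    fix x assume x: "x \<in> seq_space I"
    show "0 \<le> root n (op_norm (cocycle a x n))" by (rule real_root_ge_zero[OF op_nn])
    have "elog (op_norm (cocycle a x n)) \<le> elog (C2 * N (cocycle a x n))"
      by (intro elog_mono op_nn C2)
    also have "\<dots> = ereal (ln C2) + elog (N (cocycle a x n))"
      using C2(1) submult_norm_nonneg[OF submult] by (rule split)
    also have "\<dots> \<le> ereal (ln C2) + growth n"
      by (intro add_left_mono elog_cocycle_le_growth x)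
    finally have "ereal (1 / real n) * elog (op_norm (cocycle a x n))
        \<le> ereal (1 / real n) * (ereal (ln C2) + growth n)"
      by (intro ereal_mult_left_mono) auto
    also have "\<dots> = ereal (1 / real n) * growth n + ereal (1 / real n * ln C2)"
      using growth_finite n by (intro ereal_scale_add) simp_all
    finally show "elog (root n (op_norm (cocycle a x n)))
        \<le> ereal (1 / real n) * growth n + ereal (1 / real n * ln C2)"
      using n op_nn by (simp add: elog_root)
  qed
  have lo: "ereal (1 / real n) * growth n + ereal (- (1 / real n * ln C1)) \<le> elog (S n)"
    if n: "n \<ge> 1" for n
  proof -
    have "ereal (1 / real n) * elog (N (cocycle a x n)) \<le> elog (S n) + ereal (1 / real n * ln C1)"
      if x: "x \<in> seq_space I" for x
    proof -
      have "elog (N (cocycle a x n)) \<le> elog (C1 * op_norm (cocycle a x n))"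
        by (intro elog_mono submult_norm_nonneg[OF submult] C1)
      also have "\<dots> = ereal (ln C1) + elog (op_norm (cocycle a x n))"
        using C1(1) op_nn by (rule split)
      finally have "ereal (1 / real n) * elog (N (cocycle a x n))
          \<le> ereal (1 / real n) * (ereal (ln C1) + elog (op_norm (cocycle a x n)))"
        by (intro ereal_mult_left_mono) auto
      also have "\<dots> = elog (root n (op_norm (cocycle a x n))) + ereal (1 / real n * ln C1)"
        using n elog_less_PInfty by (subst ereal_scale_add) (simp_all add: elog_root op_nn)
      also have "\<dots> \<le> elog (S n) + ereal (1 / real n * ln C1)"
        using n x by (intro add_right_mono elog_mono S_upper real_root_ge_zero op_nn)
      finally show ?thesis .
    qed
    then have "elog (N (cocycle a x n)) \<le> ereal (real n) * (elog (S n) + ereal (1 / real n * ln C1))"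
      if "x \<in> seq_space I" for x
      using that n by (subst ereal_scale_le_iff[symmetric]) simp_all
    then have "growth n \<le> ereal (real n) * (elog (S n) + ereal (1 / real n * ln C1))"
      unfolding growth_def by (rule SUP_least)
    then have "ereal (1 / real n) * growth n \<le> elog (S n) + ereal (1 / real n * ln C1)"
      using n by (subst ereal_scale_le_iff) simp_all
    then show ?thesis
      by (cases "ereal (1 / real n) * growth n"; cases "elog (S n)") auto
  qed
  have null: "(\<lambda>n. ereal (1 / real n * c)) \<longlonglongrightarrow> 0" for c
  proof -
    have "(\<lambda>n. inverse (real n) * c) \<longlonglongrightarrow> 0 * c" by (intro tendsto_intros lim_inverse_n)
    then show ?thesis by (simp add: zero_ereal_def inverse_eq_divide)
  qed
  have lim: "(\<lambda>n. ereal (1 / real n) * growth n + ereal (1 / real n * c)) \<longlonglongrightarrow> log_jsr" for c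
    using tendsto_add_ereal_general1[OF _ growth_tendsto null[of c]] by simp
  have elog_S: "(\<lambda>n. elog (S n)) \<longlonglongrightarrow> log_jsr"
  proof (rule tendsto_sandwich[OF _ _ lim[of "- ln C1"] lim[of "ln C2"]])
    show "\<forall>\<^sub>F n in sequentially. ereal (1 / real n) * growth n + ereal (1 / real n * - ln C1) \<le> elog (S n)"
      using lo by (intro eventually_mono[OF eventually_ge_at_top[of 1]]) simp
    show "\<forall>\<^sub>F n in sequentially. elog (S n) \<le> ereal (1 / real n) * growth n + ereal (1 / real n * ln C2)"
      using up by (intro eventually_mono[OF eventually_ge_at_top[of 1]]) simp
  qed
  obtain R where R: "0 \<le> R" "elog R = log_jsr" "S \<longlonglongrightarrow> R"
    by (rule elog_tendsto_imp_tendsto[OF _ elog_S log_jsr_finite]) (simp_all add: S_nn)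
  have "joint_spectral_radius (a ` I) = R"
    unfolding joint_spectral_radius_def using R(3) by (intro limI) (simp add: S_def[abs_def])
  with R show "0 \<le> joint_spectral_radius (a ` I)" "elog (joint_spectral_radius (a ` I)) = log_jsr"
    by simp_all
qed

text \<open>Multiplicative form of \<open>log_jsr_le\<close>: the Fekete limit is an infimum, so a
  uniform bound on products of one single length already bounds \<open>R\<close>.\<close>

lemma power_le_bound:
  assumes R: "0 \<le> R" "elog R = log_jsr" and n: "n \<ge> 1"
    and b: "0 \<le> b" "\<And>x. x \<in> seq_space I \<Longrightarrow> N (cocycle a x n) \<le> b"
  shows "R ^ n \<le> b"
proof -
  have "growth n \<le> elog b"
    unfolding growth_def using b(2)
    by (intro SUP_least elog_mono submult_norm_nonneg[OF submult])
  then have "ereal (1 / real n) * growth n \<le> ereal (1 / real n) * elog b"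
    by (intro ereal_mult_left_mono) auto
  then have "elog R \<le> elog (root n b)"
    using log_jsr_le[OF n] n R(2) b(1) by (simp add: elog_root)
  then have "R \<le> root n b"
    by (rule elog_le_cancel[rotated 2]) (simp_all add: R(1) b(1) real_root_ge_zero)
  then have "R ^ n \<le> root n b ^ n" using R(1) by (rule power_mono)
  then show ?thesis using n b(1) by simp
qed

text \<open>If this fails, every point satisfies \<open>N (cocycle a x k) < \<theta> R\<^sup>k\<close> for some \<open>k \<le> n\<close>; cutting long
  products into such blocks makes them decay at a rate smaller than \<open>R\<close>.\<close>

lemma exists_long_large_products:
  assumes R: "0 < R" "elog R = log_jsr" and \<theta>: "0 < \<theta>" "\<theta> < 1"
  shows "\<exists>x\<in>seq_space I. \<forall>k\<in>{1..n}. \<theta> * R ^ k \<le> N (cocycle a x k)"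
proof (rule ccontr)
  assume "\<not> ?thesis"
  then have small: "\<exists>k\<in>{1..n}. N (cocycle a x k) < \<theta> * R ^ k" if "x \<in> seq_space I" for x
    using that by (meson not_le)
  obtain x0 where "x0 \<in> seq_space I" using X_nonempty by blast
  then have n: "n \<ge> 1" using small[of x0] by auto
  \<comment> \<open>Since \<open>q ^ n = \<theta>\<close>, the rate \<open>\<tau> = q * R\<close> is
    smaller than \<open>R\<close>, and yet \<open>\<theta> * R ^ k \<le> \<tau> ^ k\<close> for all
    block lengths \<open>k \<le> n\<close> at once.\<close>
  define q where "q = root n \<theta>"
  have q: "0 < q" "q < 1" "q ^ n = \<theta>" using \<theta> n by (auto simp: q_def)
  define \<tau> where "\<tau> = q * R"
  have \<tau>: "0 < \<tau>" using q R by (simp add: \<tau>_def)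
  have \<theta>\<tau>: "\<theta> * R ^ k \<le> \<tau> ^ k" if "k \<le> n" for k
  proof -
    have "\<theta> \<le> q ^ k" unfolding q(3)[symmetric] using q that by (intro power_decreasing) auto
    then show ?thesis using R by (simp add: \<tau>_def power_mult_distrib mult_right_mono)
  qed
  have "\<exists>b\<ge>1. \<forall>x\<in>seq_space I. N (cocycle a x m) \<le> b" for m
    using norm_cocycle_bounded[OF submult] by blast
  then obtain b where b: "\<And>m. 1 \<le> b m" "\<And>m x. x \<in> seq_space I \<Longrightarrow> N (cocycle a x m) \<le> b m"
    by metis
  \<comment> \<open>Blocks are cut off until fewer than \<open>n\<close> factors remain;
    \<open>B\<close> pays for this remainder, whatever its length.\<close>
  define B where "B = (\<Sum>m<n. b m / \<tau> ^ m)"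
  have bpos: "0 \<le> b m / \<tau> ^ m" for m using b(1)[of m] \<tau> by simp
  have B0: "0 \<le> B" unfolding B_def by (intro sum_nonneg bpos)
  have bound: "N (cocycle a x m) \<le> B * \<tau> ^ m" if "x \<in> seq_space I" for x m
    using that
  proof (induction m arbitrary: x rule: less_induct)
    case (less m)
    show ?case
    proof (cases "m < n")
      case True
      then have "b m / \<tau> ^ m \<le> B"
        unfolding B_def using bpos by (intro member_le_sum) auto
      then have "b m \<le> B * \<tau> ^ m" using \<tau> by (simp add: divide_le_eq)
      then show ?thesis using b(2)[OF less.prems] by (rule order_trans[rotated])
    next
      case False
      obtain k where k: "1 \<le> k" "k \<le> n" "N (cocycle a x k) < \<theta> * R ^ k"
        using small[OF less.prems] by auto
      have Nk: "N (cocycle a x k) \<le> \<tau> ^ k" using k(3) \<theta>\<tau>[OF k(2)] by linarith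
      have m: "m = k + (m - k)" "m - k < m" using False k by auto
      have "N (cocycle a x m) \<le> N (cocycle a ((shift ^^ k) x) (m - k)) * N (cocycle a x k)"
        by (subst m(1), subst cocycle_add) (rule submult_norm_mult[OF submult])
      also have "\<dots> \<le> (B * \<tau> ^ (m - k)) * \<tau> ^ k"
        using Nk less.IH[OF m(2) funpow_shift_seq_space[OF less.prems]] B0 \<tau>
        by (intro mult_mono submult_norm_nonneg[OF submult]) auto
      also have "\<dots> = B * \<tau> ^ m" using m by (metis mult.assoc power_add add.commute)
      finally show ?thesis .
    qed
  qed
  have le: "1 \<le> B * q ^ m" if "m \<ge> 1" for m
  proof -
    have "R ^ m \<le> B * \<tau> ^ m"
      using R(1) B0 \<tau> by (intro power_le_bound[OF _ R(2) that] bound) simp_all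
    then have "R ^ m \<le> (B * q ^ m) * R ^ m" by (simp add: \<tau>_def power_mult_distrib)
    then show ?thesis using R(1) by simp
  qed
  \<comment> \<open>The threshold is at most 1, which excludes \<open>m = 0\<close>, a length about
    which \<open>le\<close> says nothing; and \<open>B / (B + 1) < 1\<close> contradicts
    \<open>le\<close>.\<close>
  obtain m where m: "q ^ m < 1 / (B + 1)"
    using real_arch_pow_inv[of "1 / (B + 1)" q] q B0 by auto
  have "m \<noteq> 0" using m B0 by (intro notI) (simp add: field_simps)
  then have "1 \<le> B * q ^ m" using le by simp
  also have "\<dots> \<le> B * (1 / (B + 1))" using m B0 by (intro mult_left_mono) auto
  also have "\<dots> < 1" using B0 by (simp add: field_simps)
  finally show False by simp
qed

text \<open>For fixed \<open>k\<close>, the points \<open>z n\<close> satisfy the bound with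
  constant \<open>\<theta> n\<close> as soon as \<open>n \<ge> k\<close>. A limit point inherits it
  with constant 1, because \<open>\<theta> n\<close> tends to 1 and the norm of the cocycle is
  continuous. A fixed constant below 1 would settle the growth rate along \<open>y\<close>, but not
  the infimum over \<open>n\<close>.\<close>

theorem exists_extremal_sequence:
  assumes R: "0 \<le> R" "elog R = log_jsr"
  shows "\<exists>y\<in>seq_space I. \<forall>k\<ge>1. R ^ k \<le> N (cocycle a y k)"
proof (cases "R = 0")
  case True
  then show ?thesis using X_nonempty submult_norm_nonneg[OF submult] by (auto simp: power_0_left)
next
  case False
  then have R0: "0 < R" using R(1) by simp
  define \<theta> where "\<theta> n = 1 - inverse (real (Suc (Suc n)))" for n
  have \<theta>: "0 < \<theta> n" "\<theta> n < 1" for n by (auto simp: \<theta>_def field_simps)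
  have "\<exists>x\<in>seq_space I. \<forall>k\<in>{1..n}. \<theta> n * R ^ k \<le> N (cocycle a x k)" for n
    using exists_long_large_products[OF R0 R(2) \<theta>] .
  then obtain z where z: "\<And>n. z n \<in> seq_space I"
    "\<And>n k. k \<in> {1..n} \<Longrightarrow> \<theta> n * R ^ k \<le> N (cocycle a (z n) k)"
    by metis
  obtain y r where y: "y \<in> seq_space I" and r: "strict_mono (r :: nat \<Rightarrow> nat)"
    and lim: "(z \<circ> r) \<longlonglongrightarrow> y"
    using compact_X z(1) unfolding compact_def by blast
  have "R ^ k \<le> N (cocycle a y k)" if "k \<ge> 1" for k
  proof (rule LIMSEQ_le)
    have "(\<lambda>n. 1 - inverse (real (Suc (Suc n)))) \<longlonglongrightarrow> 1 - 0"
      by (intro tendsto_intros LIMSEQ_Suc[OF LIMSEQ_inverse_real_of_nat])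
    then have "\<theta> \<longlonglongrightarrow> 1" by (simp add: \<theta>_def[abs_def])
    from tendsto_mult_right[OF LIMSEQ_subseq_LIMSEQ[OF this r], of "R ^ k"]
    show "(\<lambda>n. \<theta> (r n) * R ^ k) \<longlonglongrightarrow> R ^ k" by (simp add: o_def)
    show "(\<lambda>n. N (cocycle a ((z \<circ> r) n) k)) \<longlonglongrightarrow> N (cocycle a y k)"
      using continuous_on_norm_cocycle[OF submult, of k] lim y z(1)
      by (auto simp: continuous_on_sequentially o_def)
    show "\<exists>M. \<forall>n\<ge>M. \<theta> (r n) * R ^ k \<le> N (cocycle a ((z \<circ> r) n) k)"
    proof (intro exI allI impI)
      fix n assume "k \<le> n"
      then have "k \<le> r n" using seq_suble[OF r, of n] by simp
      then show "\<theta> (r n) * R ^ k \<le> N (cocycle a ((z \<circ> r) n) k)"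
        using z(2) that by simp
    qed
  qed
  then show ?thesis using y by blast
qed

end

section \<open>Integrals of extended real functions\<close>

lemma elog_measurable [measurable]: "elog \<in> borel_measurable borel"
  unfolding elog_def[abs_def] by measurable

text \<open>Passing to the nonnegative deficit \<open>K - f\<close> removes the difference of two integrals.\<close>

lemma eintegral_deficit:
  assumes \<mu>: "prob_space \<mu>" and f[measurable]: "f \<in> borel_measurable \<mu>"
    and K: "0 \<le> K" "\<And>x. x \<in> space \<mu> \<Longrightarrow> f x \<le> ereal K"
  shows "eintegral \<mu> f = ereal K - enn2ereal (\<integral>\<^sup>+x. e2ennreal (ereal K - f x) \<partial>\<mu>)"
proof -
  interpret prob_space \<mu> by fact
  define D where "D = (\<integral>\<^sup>+x. e2ennreal (ereal K - f x) \<partial>\<mu>)"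
  define p where "p = (\<integral>\<^sup>+x. e2ennreal (f x) \<partial>\<mu>)"
  define q where "q = (\<integral>\<^sup>+x. e2ennreal (- f x) \<partial>\<mu>)"
  have pt: "e2ennreal (ereal K - f x) + e2ennreal (f x) = ennreal K + e2ennreal (- f x)"
    if "x \<in> space \<mu>" for x
  proof (cases "f x")
    case (real r)
    then have "r \<le> K" using K(2)[OF that] by simp
    then show ?thesis
      using K(1) real by (cases "0 \<le> r") (simp_all add: ennreal_plus[symmetric] ennreal_neg del: ennreal_plus)
  qed (use K(2)[OF that] in auto)
  have "D + p = (\<integral>\<^sup>+x. e2ennreal (ereal K - f x) + e2ennreal (f x) \<partial>\<mu>)"
    unfolding D_def p_def by (rule nn_integral_add[symmetric]) measurable
  also have "\<dots> = (\<integral>\<^sup>+x. ennreal K + e2ennreal (- f x) \<partial>\<mu>)"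
    by (intro nn_integral_cong pt)
  also have "\<dots> = (\<integral>\<^sup>+x. ennreal K \<partial>\<mu>) + q"
    unfolding q_def by (rule nn_integral_add) measurable
  also have "(\<integral>\<^sup>+x. ennreal K \<partial>\<mu>) = ennreal K" by (simp add: emeasure_space_1)
  finally have eq: "D + p = ennreal K + q" .
  \<comment> \<open>Finiteness of \<open>p\<close> lets \<open>eq\<close> be solved for the
    difference of \<open>p\<close> and \<open>q\<close>, also when \<open>q\<close> is
    infinite.\<close>
  have "p \<le> (\<integral>\<^sup>+x. ennreal K \<partial>\<mu>)"
    unfolding p_def using K(2) by (intro nn_integral_mono) (metis e2ennreal_ereal e2ennreal_mono)
  then have p: "p \<noteq> top" by (auto simp: emeasure_space_1 dest: neq_top_trans[OF ennreal_neq_top])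
  then obtain P where P: "p = ennreal P" "0 \<le> P" by (cases p rule: ennreal_cases) auto
  have "enn2ereal p - enn2ereal q = ereal K - enn2ereal D"
  proof (cases q rule: ennreal_cases)
    case (real Q)
    then have "D \<noteq> top" using eq K(1) P by (auto simp flip: ennreal_plus)
    then obtain d where d: "D = ennreal d" "0 \<le> d" by (cases D rule: ennreal_cases) auto
    have "ennreal (d + P) = ennreal (K + Q)" using eq P d real K(1) by simp
    then have "d + P = K + Q" using P d real K(1) by (subst (asm) ennreal_inj) auto
    then show ?thesis using P d real by (simp add: algebra_simps)
  next
    case top
    then have "D = top" using eq P by (cases D rule: ennreal_cases) (auto simp flip: ennreal_plus)
    then show ?thesis using top P by simp
  qed
  then show ?thesis by (simp add: eintegral_def D_def p_def q_def)
qed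

lemma eintegral_le:
  assumes \<mu>: "prob_space \<mu>" and f: "f \<in> borel_measurable \<mu>"
    and c: "\<And>x. x \<in> space \<mu> \<Longrightarrow> f x \<le> c"
  shows "eintegral \<mu> f \<le> c"
proof -
  interpret prob_space \<mu> by fact
  have le: "eintegral \<mu> f \<le> ereal r" if r: "c \<le> ereal r" for r
  proof -
    \<comment> \<open>\<open>r\<close> may be negative, since \<open>c = - \<infinity>\<close> is
      treated through all real \<open>r\<close>, while \<open>eintegral_deficit\<close> takes a
      nonnegative bound.\<close>
    define K where "K = max 0 r"
    have fr: "f x \<le> ereal r" if "x \<in> space \<mu>" for x using c[OF that] r by (rule order_trans)
    have fK: "f x \<le> ereal K" if "x \<in> space \<mu>" for x
      using fr[OF that] by (rule order_trans) (simp add: K_def)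
    have "ennreal (K - r) = (\<integral>\<^sup>+x. ennreal (K - r) \<partial>\<mu>)" by (simp add: emeasure_space_1)
    also have "\<dots> \<le> (\<integral>\<^sup>+x. e2ennreal (ereal K - f x) \<partial>\<mu>)"
    proof (rule nn_integral_mono)
      fix x assume "x \<in> space \<mu>"
      then have "ereal K - ereal r \<le> ereal K - f x" using fr by (intro ereal_minus_mono) auto
      then show "ennreal (K - r) \<le> e2ennreal (ereal K - f x)"
        using e2ennreal_mono by fastforce
    qed
    finally have "enn2ereal (ennreal (K - r)) \<le> enn2ereal (\<integral>\<^sup>+x. e2ennreal (ereal K - f x) \<partial>\<mu>)"
      by (simp only: less_eq_ennreal.rep_eq)
    then have "ereal (K - r) \<le> enn2ereal (\<integral>\<^sup>+x. e2ennreal (ereal K - f x) \<partial>\<mu>)"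
      by (simp add: K_def)
    then have "ereal K - enn2ereal (\<integral>\<^sup>+x. e2ennreal (ereal K - f x) \<partial>\<mu>) \<le> ereal K - ereal (K - r)"
      by (intro ereal_minus_mono) auto
    moreover have "0 \<le> K" by (simp add: K_def)
    ultimately show ?thesis
      using eintegral_deficit[OF \<mu> f _ fK] by simp
  qed
  show ?thesis
  proof (cases c)
    case MInf
    then have "eintegral \<mu> f \<le> ereal r" for r by (intro le) simp
    then show ?thesis using MInf ereal_bot by auto
  qed (use le in auto)
qed

text \<open>In terms of deficits the last hypothesis reads
  \<open>(K - f) + (L - g) \<le> (K + L) - h\<close>. These functions are nonnegative, so their
  integrals add even when they are infinite.\<close>

lemma eintegral_add_le:
  assumes \<mu>: "prob_space \<mu>"
    and f[measurable]: "f \<in> borel_measurable \<mu>" and g[measurable]: "g \<in> borel_measurable \<mu>"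
    and h[measurable]: "h \<in> borel_measurable \<mu>"
    and K: "0 \<le> K" "\<And>x. x \<in> space \<mu> \<Longrightarrow> f x \<le> ereal K"
    and L: "0 \<le> L" "\<And>x. x \<in> space \<mu> \<Longrightarrow> g x \<le> ereal L"
    and le: "\<And>x. x \<in> space \<mu> \<Longrightarrow> h x \<le> f x + g x"
  shows "eintegral \<mu> h \<le> eintegral \<mu> f + eintegral \<mu> g"
proof -
  define F where "F = (\<integral>\<^sup>+x. e2ennreal (ereal K - f x) \<partial>\<mu>)"
  define G where "G = (\<integral>\<^sup>+x. e2ennreal (ereal L - g x) \<partial>\<mu>)"
  define H where "H = (\<integral>\<^sup>+x. e2ennreal (ereal (K + L) - h x) \<partial>\<mu>)"
  have hKL: "h x \<le> ereal (K + L)" if "x \<in> space \<mu>" for x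
    using order_trans[OF le[OF that] add_mono[OF K(2)[OF that] L(2)[OF that]]] by simp
  have "F + G = (\<integral>\<^sup>+x. e2ennreal (ereal K - f x) + e2ennreal (ereal L - g x) \<partial>\<mu>)"
    unfolding F_def G_def by (rule nn_integral_add[symmetric]) measurable
  also have "\<dots> \<le> H"
    unfolding H_def
  proof (rule nn_integral_mono)
    fix x assume x: "x \<in> space \<mu>"
    show "e2ennreal (ereal K - f x) + e2ennreal (ereal L - g x) \<le> e2ennreal (ereal (K + L) - h x)"
    proof (cases "h x")
      case (real r)
      then obtain s t where st: "f x = ereal s" "g x = ereal t"
        using le[OF x] K(2)[OF x] L(2)[OF x] by (cases "f x"; cases "g x") auto
      then show ?thesis
        using real le[OF x] K(2)[OF x] L(2)[OF x]
        by (simp add: ennreal_plus[symmetric] ennreal_leI del: ennreal_plus)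
    qed (use hKL[OF x] in auto)
  qed
  finally have "enn2ereal (F + G) \<le> enn2ereal H" by (simp only: less_eq_ennreal.rep_eq)
  then have "enn2ereal F + enn2ereal G \<le> enn2ereal H" by (simp add: plus_ennreal.rep_eq)
  then have "ereal (K + L) - enn2ereal H \<le> ereal (K + L) - (enn2ereal F + enn2ereal G)"
    by (intro ereal_minus_mono) auto
  also have "\<dots> = (ereal K - enn2ereal F) + (ereal L - enn2ereal G)"
    by (cases "enn2ereal F"; cases "enn2ereal G") (auto simp: enn2ereal_nonneg)
  finally show ?thesis
    using eintegral_deficit[OF \<mu> f K] eintegral_deficit[OF \<mu> g L]
      eintegral_deficit[OF \<mu> h add_nonneg_nonneg[OF K(1) L(1)] hKL]
    by (simp add: F_def G_def H_def)
qed

text \<open>The integral of the deficit is affine in the measure by the definition of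
  \<open>mixture\<close>, and \<open>K\<close> splits as \<open>t * K + (1 - t) * K\<close>.\<close>

lemma eintegral_mixture:
  assumes P: "prob_space \<mu>" "prob_space \<mu>'" "prob_space \<nu>"
    and sets: "sets \<mu> = sets \<nu>" "sets \<mu>' = sets \<nu>"
    and mix: "mixture t \<mu> \<mu>' \<nu>" and t: "0 < t" "t < 1"
    and f[measurable]: "f \<in> borel_measurable \<nu>"
    and K: "0 \<le> K" "\<And>x. x \<in> space \<nu> \<Longrightarrow> f x \<le> ereal K"
  shows "eintegral \<nu> f = ereal t * eintegral \<mu> f + ereal (1 - t) * eintegral \<mu>' f"
proof -
  define D where "D \<kappa> = (\<integral>\<^sup>+x. e2ennreal (ereal K - f x) \<partial>\<kappa>)" for \<kappa>
  have f': "f \<in> borel_measurable \<mu>" "f \<in> borel_measurable \<mu>'"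
    using f sets by (simp_all cong: measurable_cong_sets)
  have sp: "space \<mu> = space \<nu>" "space \<mu>' = space \<nu>"
    using sets by (auto dest: sets_eq_imp_space_eq)
  have "D \<nu> = ennreal t * D \<mu> + ennreal (1 - t) * D \<mu>'"
    using mix unfolding D_def mixture_def by (rule bspec) measurable
  then have "enn2ereal (D \<nu>) = ereal t * enn2ereal (D \<mu>) + ereal (1 - t) * enn2ereal (D \<mu>')"
    using t by (simp add: plus_ennreal.rep_eq times_ennreal.rep_eq)
  moreover have "ereal K - (ereal t * x + ereal (1 - t) * y)
      = ereal t * (ereal K - x) + ereal (1 - t) * (ereal K - y)" if "0 \<le> x" "0 \<le> y" for x y
    using that t by (cases x; cases y) (auto simp: algebra_simps)
  ultimately have "ereal K - enn2ereal (D \<nu>)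
      = ereal t * (ereal K - enn2ereal (D \<mu>)) + ereal (1 - t) * (ereal K - enn2ereal (D \<mu>'))"
    by (simp add: enn2ereal_nonneg)
  then show ?thesis
    using eintegral_deficit[OF P(3) f K] eintegral_deficit[OF P(1) f'(1) K(1)]
      eintegral_deficit[OF P(2) f'(2) K(1)] K(2)
    by (simp add: D_def sp)
qed

lemma eintegral_invariant:
  assumes T: "T \<in> measurable \<mu> \<mu>" "distr \<mu> \<mu> T = \<mu>" and f[measurable]: "f \<in> borel_measurable \<mu>"
  shows "eintegral \<mu> (\<lambda>x. f ((T ^^ m) x)) = eintegral \<mu> f"
proof -
  have nn: "(\<integral>\<^sup>+x. h ((T ^^ m) x) \<partial>\<mu>) = (\<integral>\<^sup>+x. h x \<partial>\<mu>)"
    if "h \<in> borel_measurable \<mu>" for h :: "_ \<Rightarrow> ennreal"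
    using that
  proof (induction m arbitrary: h)
    case (Suc m)
    have "(\<integral>\<^sup>+x. h (T x) \<partial>\<mu>) = (\<integral>\<^sup>+x. h x \<partial>distr \<mu> \<mu> T)"
      using Suc.prems T(1) by (subst nn_integral_distr) simp_all
    moreover have "(\<lambda>x. h (T x)) \<in> borel_measurable \<mu>"
      using T(1) Suc.prems by (rule measurable_compose)
    ultimately show ?case using Suc.IH[of "\<lambda>x. h (T x)"] T(2) by simp
  qed simp
  show ?thesis
    unfolding eintegral_def
    using nn[of "\<lambda>x. e2ennreal (f x)"] nn[of "\<lambda>x. e2ennreal (- f x)"] by simp
qed

section \<open>Truncated logarithms and weak upper semicontinuity\<close>

lemma continuous_on_truncated_ln:
  fixes F :: "'a::topological_space \<Rightarrow> real"
  assumes "continuous_on X F"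
  shows "continuous_on X (\<lambda>x. K - ln (max (F x) (exp c)))"
proof -
  have "max (F x) (exp c) \<noteq> 0" for x
    by (metis exp_gt_zero less_max_iff_disj less_irrefl)
  then show ?thesis using assms
    by (intro continuous_on_diff continuous_on_const continuous_on_ln continuous_on_max) auto
qed

lemma truncated_ln_nonneg:
  assumes "t \<le> exp K"
  shows "0 \<le> K - ln (max t (exp (K - real j)))"
proof -
  have "ln (max t (exp (K - real j))) \<le> ln (exp K)"
    using assms by (intro ln_mono) (auto simp: less_max_iff_disj)
  then show ?thesis by simp
qed

text \<open>\<open>K - ln (max (F x) (exp (K - j)))\<close> is the smaller of the deficit
  \<open>K - elog (F x)\<close> and \<open>j\<close>. As \<open>j\<close> grows it increases to the
  deficit, also at the zeros of \<open>F\<close>, where it equals \<open>j\<close>; so bounds for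
  these continuous functions pass to the deficit by monotone convergence.\<close>

lemma eintegral_elog_truncation:
  fixes F :: "'a::metric_space \<Rightarrow> real"
  assumes X: "compact X" and F: "continuous_on X F" "\<And>x. x \<in> X \<Longrightarrow> 0 \<le> F x"
    and K: "0 \<le> K" "\<And>x. x \<in> X \<Longrightarrow> F x \<le> exp K" and \<nu>: "\<nu> \<in> borel_probs X"
    and le: "\<And>j. (\<integral>x. K - ln (max (F x) (exp (K - real j))) \<partial>\<nu>) \<le> K - c"
  shows "ereal c \<le> eintegral \<nu> (\<lambda>x. elog (F x))"
proof -
  define h where "h j x = K - ln (max (F x) (exp (K - real j)))" for j x
  have pos: "0 < max (F x) (exp (K - real j))" for x j
    by (simp add: less_max_iff_disj)
  have h_cont: "continuous_on X (h j)" for j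
    unfolding h_def using F(1) by (rule continuous_on_truncated_ln)
  have h_nonneg: "0 \<le> h j x" if "x \<in> X" for j x
    unfolding h_def using K(2)[OF that] by (rule truncated_ln_nonneg)
  have P: "prob_space \<nu>" using \<nu> by (simp add: borel_probs_def)
  have sp: "space \<nu> = X" using \<nu> by (rule space_borel_probs)
  have hm[measurable]: "h j \<in> borel_measurable \<nu>" for j
    using \<nu> h_cont by (rule borel_probs_measurable)
  have Fm[measurable]: "F \<in> borel_measurable \<nu>" using \<nu> F(1) by (rule borel_probs_measurable)
  have inc: "incseq (\<lambda>j x. ennreal (h j x))"
    unfolding h_def
    by (intro incseq_SucI le_funI ennreal_leI diff_left_mono ln_mono max.mono pos) auto
  have "(\<integral>\<^sup>+x. e2ennreal (ereal K - elog (F x)) \<partial>\<nu>) \<le> (\<integral>\<^sup>+x. (SUP j. ennreal (h j x)) \<partial>\<nu>)"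
  proof (rule nn_integral_mono)
    fix x assume "x \<in> space \<nu>"
    then have Fx: "0 \<le> F x" using F(2) sp by simp
    show "e2ennreal (ereal K - elog (F x)) \<le> (SUP j. ennreal (h j x))"
    proof (cases "F x = 0")
      case True
      then have "ennreal (h j x) = of_nat j" for j
        by (simp add: h_def max_def ennreal_of_nat_eq_real_of_nat)
      then show ?thesis by (simp add: ennreal_SUP_of_nat_eq_top)
    next
      case False
      then have F0: "0 < F x" using Fx by simp
      obtain j where j: "K - ln (F x) \<le> real j" using real_arch_simple by blast
      have "exp (K - real j) \<le> exp (ln (F x))" using j by simp
      then have "exp (K - real j) \<le> F x" using F0 by (simp only: exp_ln)
      then have "h j x = K - ln (F x)" by (simp add: h_def max_absorb1)
      then have "e2ennreal (ereal K - elog (F x)) = ennreal (h j x)"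
        using F0 by (simp add: elog_def)
      also have "\<dots> \<le> (SUP j. ennreal (h j x))" by (rule SUP_upper) simp
      finally show ?thesis .
    qed
  qed
  also have "\<dots> = (SUP j. \<integral>\<^sup>+x. ennreal (h j x) \<partial>\<nu>)"
    using inc by (intro nn_integral_monotone_convergence_SUP) measurable
  also have "\<dots> \<le> ennreal (K - c)"
  proof (rule SUP_least)
    fix j
    have "(\<integral>\<^sup>+x. ennreal (h j x) \<partial>\<nu>) = ennreal (\<integral>x. h j x \<partial>\<nu>)"
      using h_nonneg borel_probs_integrable[OF X \<nu> h_cont]
      by (intro nn_integral_eq_integral) (auto simp: sp)
    also have "\<dots> \<le> ennreal (K - c)" using le[of j] by (intro ennreal_leI) (simp add: h_def)
    finally show "(\<integral>\<^sup>+x. ennreal (h j x) \<partial>\<nu>) \<le> ennreal (K - c)" .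
  qed
  finally have D: "(\<integral>\<^sup>+x. e2ennreal (ereal K - elog (F x)) \<partial>\<nu>) \<le> ennreal (K - c)" .
  \<comment> \<open>\<open>ennreal\<close> sends negative reals to 0, so \<open>K - c\<close> must
    be nonnegative before \<open>D\<close> can be read back in \<open>ereal\<close>.\<close>
  have "0 \<le> (\<integral>x. h 0 x \<partial>\<nu>)"
    using h_nonneg by (intro integral_nonneg_AE AE_I2) (simp add: sp)
  then have "0 \<le> K - c" using le[of 0] by (simp add: h_def)
  have "enn2ereal (\<integral>\<^sup>+x. e2ennreal (ereal K - elog (F x)) \<partial>\<nu>) \<le> enn2ereal (ennreal (K - c))"
    using D by (simp only: less_eq_ennreal.rep_eq)
  also have "\<dots> = ereal (K - c)" using \<open>0 \<le> K - c\<close> by simp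
  finally have "ereal K - ereal (K - c)
      \<le> ereal K - enn2ereal (\<integral>\<^sup>+x. e2ennreal (ereal K - elog (F x)) \<partial>\<nu>)"
    by (intro ereal_minus_mono) auto
  moreover have "elog (F x) \<le> ereal K" if "x \<in> space \<nu>" for x
    using that F(2) K(2) sp by (simp add: elog_le_iff)
  ultimately show ?thesis
    using eintegral_deficit[OF P _ K(1), of "\<lambda>x. elog (F x)"] by simp
qed

text \<open>The converse of \<open>eintegral_elog_truncation\<close>, as each truncation lies below
  the deficit. Together they translate a lower bound on the integral of a logarithm into conditions
  on integrals of continuous functions.\<close>

lemma truncation_le_of_eintegral:
  fixes F :: "'a::metric_space \<Rightarrow> real"
  assumes X: "compact X" and F: "continuous_on X F" "\<And>x. x \<in> X \<Longrightarrow> 0 \<le> F x"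
    and K: "0 \<le> K" "\<And>x. x \<in> X \<Longrightarrow> F x \<le> exp K" and \<nu>: "\<nu> \<in> borel_probs X"
    and le: "ereal c \<le> eintegral \<nu> (\<lambda>x. elog (F x))"
  shows "(\<integral>x. K - ln (max (F x) (exp (K - real j))) \<partial>\<nu>) \<le> K - c"
proof -
  define h where "h x = K - ln (max (F x) (exp (K - real j)))" for x
  have h_cont: "continuous_on X h"
    unfolding h_def using F(1) by (rule continuous_on_truncated_ln)
  have h_nonneg: "0 \<le> h x" if "x \<in> X" for x
    unfolding h_def using K(2)[OF that] by (rule truncated_ln_nonneg)
  have P: "prob_space \<nu>" using \<nu> by (simp add: borel_probs_def)
  have sp: "space \<nu> = X" using \<nu> by (rule space_borel_probs)
  have Fm[measurable]: "F \<in> borel_measurable \<nu>" using \<nu> F(1) by (rule borel_probs_measurable)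
  define D where "D = (\<integral>\<^sup>+x. e2ennreal (ereal K - elog (F x)) \<partial>\<nu>)"
  have "ennreal (\<integral>x. h x \<partial>\<nu>) = (\<integral>\<^sup>+x. ennreal (h x) \<partial>\<nu>)"
    using h_nonneg borel_probs_integrable[OF X \<nu> h_cont]
    by (intro nn_integral_eq_integral[symmetric]) (auto simp: sp)
  also have "\<dots> \<le> D"
    unfolding D_def
  proof (rule nn_integral_mono)
    fix x assume "x \<in> space \<nu>"
    then have Fx: "0 \<le> F x" using F(2) sp by simp
    have "ereal (h x) \<le> ereal K - elog (F x)"
    proof (cases "F x = 0")
      case False
      then have "ln (F x) \<le> ln (max (F x) (exp (K - real j)))"
        using Fx by (intro ln_mono) auto
      then show ?thesis using False by (simp add: elog_def h_def)
    qed (simp add: elog_def)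
    then show "ennreal (h x) \<le> e2ennreal (ereal K - elog (F x))"
      using e2ennreal_mono by fastforce
  qed
  finally have "enn2ereal (ennreal (\<integral>x. h x \<partial>\<nu>)) \<le> enn2ereal D"
    by (simp only: less_eq_ennreal.rep_eq)
  moreover have "0 \<le> (\<integral>x. h x \<partial>\<nu>)"
    using h_nonneg by (intro integral_nonneg_AE AE_I2) (simp add: sp)
  ultimately have hD: "ereal (\<integral>x. h x \<partial>\<nu>) \<le> enn2ereal D" by simp
  have "elog (F x) \<le> ereal K" if "x \<in> space \<nu>" for x
    using that F(2) K(2) sp by (simp add: elog_le_iff)
  then have "ereal c \<le> ereal K - enn2ereal D"
    using le eintegral_deficit[OF P _ K(1), of "\<lambda>x. elog (F x)"] by (simp add: D_def)
  then show ?thesis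
    using hD by (cases "enn2ereal D") (auto simp: h_def)
qed

text \<open>For each \<open>j\<close> the truncated integrals converge and keep their upper bound.
  The hypothesis is only eventual because along a maximizing sequence a value is a lower bound only
  from its own index on.\<close>

lemma eintegral_elog_weak_limit:
  fixes F :: "'a::metric_space \<Rightarrow> real"
  assumes X: "compact X" and F: "continuous_on X F" "\<And>x. x \<in> X \<Longrightarrow> 0 \<le> F x"
    and K: "0 \<le> K" "\<And>x. x \<in> X \<Longrightarrow> F x \<le> exp K"
    and \<mu>: "\<And>m. \<mu> m \<in> borel_probs X" and \<nu>: "\<nu> \<in> borel_probs X" and w: "weak_limit X \<mu> \<nu>"
    and le: "\<forall>\<^sub>F m in sequentially. ereal c \<le> eintegral (\<mu> m) (\<lambda>x. elog (F x))"
  shows "ereal c \<le> eintegral \<nu> (\<lambda>x. elog (F x))"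
proof (rule eintegral_elog_truncation[OF X F K \<nu>])
  fix j
  have "continuous_on X (\<lambda>x. K - ln (max (F x) (exp (K - real j))))"
    using F(1) by (rule continuous_on_truncated_ln)
  then have "(\<lambda>m. \<integral>x. K - ln (max (F x) (exp (K - real j))) \<partial>\<mu> m)
      \<longlonglongrightarrow> (\<integral>x. K - ln (max (F x) (exp (K - real j))) \<partial>\<nu>)"
    using w by (simp add: weak_limit_def)
  moreover have "\<forall>\<^sub>F m in sequentially. (\<integral>x. K - ln (max (F x) (exp (K - real j))) \<partial>\<mu> m) \<le> K - c"
    using le by eventually_elim (rule truncation_le_of_eintegral[OF X F K \<mu>])
  ultimately show "(\<integral>x. K - ln (max (F x) (exp (K - real j))) \<partial>\<nu>) \<le> K - c"
    by (rule tendsto_upperbound) simp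
qed

section \<open>Maximizing measures\<close>

text \<open>Both sides are the sum of \<open>v\<close> over the first \<open>m + n\<close> indices
  minus the sums over the first \<open>m\<close> and the first \<open>n\<close>.\<close>

lemma sum_shift_diff:
  fixes v :: "nat \<Rightarrow> real"
  shows "(\<Sum>i<m. v (i + n) - v i) = (\<Sum>k<n. v (m + k) - v k)"
proof (induction m)
  case (Suc m)
  have "v (m + n) - v m = (\<Sum>k<n. v (Suc m + k) - v (m + k))"
    using sum_lessThan_telescope[of "\<lambda>k. v (m + k)" n] by simp
  then show ?case using Suc by (simp add: sum_subtractf)
qed simp

text \<open>With positive weights, a term below \<open>s\<close> would pull the average below
  \<open>s\<close>. This is what makes sets of maximizers faces.\<close>

lemma ereal_convex_combination_eq_max:
  fixes x y s :: ereal
  assumes "x \<le> s" "y \<le> s" "s < \<infinity>" "0 < t" "t < 1" "s \<le> ereal t * x + ereal (1 - t) * y"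
  shows "x = s"
proof (cases s)
  case (real r)
  then obtain u v where uv: "x = ereal u" "y = ereal v"
    using assms by (cases x; cases y) auto
  have "(1 - t) * v \<le> (1 - t) * r" using assms(2,5) real uv by (intro mult_left_mono) auto
  then have "t * r \<le> t * u" using assms(6) real uv by (simp add: algebra_simps)
  then show ?thesis using assms(1,4) real uv by simp
qed (use assms in auto)

lemma invariant_measures_eq: "invariant_measures I = invariant_probs (seq_space I) shift"
  by (auto simp: invariant_measures_def invariant_probs_def borel_probs_def)

context indexed_cocycle
begin

lemma invariant_borel: "\<mu> \<in> invariant_measures I \<Longrightarrow> \<mu> \<in> borel_probs (seq_space I)"
  by (simp add: invariant_measures_eq invariant_probs_def)

lemma elog_cocycle_measurable:
  assumes "\<mu> \<in> borel_probs (seq_space I)"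
  shows "(\<lambda>x. elog (N (cocycle a x n))) \<in> borel_measurable \<mu>"
  using borel_probs_measurable[OF assms continuous_on_norm_cocycle[OF submult]] by measurable

lemma eintegral_le_growth:
  assumes "\<mu> \<in> borel_probs (seq_space I)"
  shows "eintegral \<mu> (\<lambda>x. elog (N (cocycle a x n))) \<le> growth n"
  using assms space_borel_probs[OF assms]
  by (intro eintegral_le elog_cocycle_measurable elog_cocycle_le_growth) (simp_all add: borel_probs_def)

lemma mean_log_le_growth:
  assumes "\<mu> \<in> borel_probs (seq_space I)"
  shows "mean_log N a \<mu> n \<le> ereal (1 / real n) * growth n"
  unfolding mean_log_def by (intro ereal_mult_left_mono eintegral_le_growth assms) simp

lemma scaled_growth_finite: "ereal (1 / real n) * growth n < \<infinity>"
  using growth_finite[of n] by (cases "growth n"; cases "n = 0") (auto simp: zero_ereal_def[symmetric])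

text \<open>When the subadditivity of the logarithms is integrated, invariance of
  \<open>\<mu>\<close> removes the shift, so the integrals form a subadditive sequence.\<close>

lemma mean_log_tendsto:
  assumes \<mu>: "\<mu> \<in> invariant_measures I"
  shows "(\<lambda>n. mean_log N a \<mu> n) \<longlonglongrightarrow> (INF n\<in>{1..}. mean_log N a \<mu> n)"
  unfolding mean_log_def
proof (rule fekete_ereal)
  note b = invariant_borel[OF \<mu>]
  have P: "prob_space \<mu>" using b by (simp add: borel_probs_def)
  have sp: "space \<mu> = seq_space I" using b by (rule space_borel_probs)
  have Tm: "shift \<in> measurable \<mu> \<mu>"
    using b continuous_on_shift shift_seq_space by (rule borel_probs_measurable_self)
  have inv: "distr \<mu> \<mu> shift = \<mu>" using \<mu> by (simp add: invariant_measures_def)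
  show "eintegral \<mu> (\<lambda>x. elog (N (cocycle a x n))) < \<infinity>" for n
    using eintegral_le_growth[OF b] growth_finite by (rule le_less_trans)
  fix m n
  obtain K where K: "0 \<le> K" "\<And>x. x \<in> seq_space I \<Longrightarrow> elog (N (cocycle a x m)) \<le> ereal K"
    using elog_cocycle_bounded by blast
  obtain L where L: "0 \<le> L" "\<And>x. x \<in> seq_space I \<Longrightarrow> elog (N (cocycle a x n)) \<le> ereal L"
    using elog_cocycle_bounded by blast
  have Tpow: "(shift ^^ m) \<in> measurable \<mu> \<mu>"
    by (induction m) (use Tm in \<open>auto intro: measurable_comp simp: id_def\<close>)
  have "eintegral \<mu> (\<lambda>x. elog (N (cocycle a x (m + n))))
      \<le> eintegral \<mu> (\<lambda>x. elog (N (cocycle a x m)))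
        + eintegral \<mu> (\<lambda>x. elog (N (cocycle a ((shift ^^ m) x) n)))"
  proof (rule eintegral_add_le[OF P elog_cocycle_measurable[OF b] _ elog_cocycle_measurable[OF b]])
    show "(\<lambda>x. elog (N (cocycle a ((shift ^^ m) x) n))) \<in> borel_measurable \<mu>"
      using Tpow elog_cocycle_measurable[OF b] by (rule measurable_compose)
    show "elog (N (cocycle a x m)) \<le> ereal K" if "x \<in> space \<mu>" for x using K(2) that sp by simp
    show "elog (N (cocycle a ((shift ^^ m) x) n)) \<le> ereal L" if "x \<in> space \<mu>" for x
      using that sp by (intro L(2) funpow_shift_seq_space) simp
    show "elog (N (cocycle a x (m + n)))
        \<le> elog (N (cocycle a x m)) + elog (N (cocycle a ((shift ^^ m) x) n))" for x
      by (rule elog_cocycle_add)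
  qed (rule K(1) L(1))+
  then show "eintegral \<mu> (\<lambda>x. elog (N (cocycle a x (m + n))))
      \<le> eintegral \<mu> (\<lambda>x. elog (N (cocycle a x m))) + eintegral \<mu> (\<lambda>x. elog (N (cocycle a x n)))"
    using eintegral_invariant[OF Tm inv elog_cocycle_measurable[OF b]] by simp
qed

lemma mean_log_mixture:
  assumes \<mu>: "\<mu> \<in> borel_probs (seq_space I)" and \<mu>': "\<mu>' \<in> borel_probs (seq_space I)"
    and \<nu>: "\<nu> \<in> borel_probs (seq_space I)" and mix: "mixture t \<mu> \<mu>' \<nu>" and t: "0 < t" "t < 1"
    and n: "n \<ge> 1"
  shows "mean_log N a \<nu> n = ereal t * mean_log N a \<mu> n + ereal (1 - t) * mean_log N a \<mu>' n"
proof -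
  obtain K where K: "0 \<le> K" "\<And>x. x \<in> seq_space I \<Longrightarrow> elog (N (cocycle a x n)) \<le> ereal K"
    using elog_cocycle_bounded by blast
  define E where "E \<kappa> = eintegral \<kappa> (\<lambda>x. elog (N (cocycle a x n)))" for \<kappa>
  have "E \<nu> = ereal t * E \<mu> + ereal (1 - t) * E \<mu>'"
    unfolding E_def using \<mu> \<mu>' \<nu> K space_borel_probs[OF \<nu>]
    by (intro eintegral_mixture[OF _ _ _ _ _ mix t] elog_cocycle_measurable) (auto simp: borel_probs_def)
  moreover have "E \<mu> < \<infinity>" "E \<mu>' < \<infinity>"
    unfolding E_def using \<mu> \<mu>' eintegral_le_growth growth_finite le_less_trans by blast+
  ultimately have "ereal (1 / real n) * E \<nu>
      = ereal t * (ereal (1 / real n) * E \<mu>) + ereal (1 - t) * (ereal (1 / real n) * E \<mu>')"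
    using t n by (cases "E \<mu>"; cases "E \<mu>'") (auto simp: field_simps)
  then show ?thesis by (simp add: mean_log_def E_def)
qed

lemma mean_log_weak_limit:
  assumes \<mu>: "\<And>m. \<mu> m \<in> borel_probs (seq_space I)" and \<nu>: "\<nu> \<in> borel_probs (seq_space I)"
    and w: "weak_limit (seq_space I) \<mu> \<nu>" and n: "n \<ge> 1"
    and le: "\<forall>\<^sub>F m in sequentially. c \<le> mean_log N a (\<mu> m) n"
  shows "c \<le> mean_log N a \<nu> n"
proof (cases c)
  case (real r)
  obtain B where B: "1 \<le> B" "\<And>x. x \<in> seq_space I \<Longrightarrow> N (cocycle a x n) \<le> B"
    using norm_cocycle_bounded[OF submult] by blast
  have "ereal (real n * r) \<le> eintegral \<nu> (\<lambda>x. elog (N (cocycle a x n)))"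
  proof (rule eintegral_elog_weak_limit[OF compact_X continuous_on_norm_cocycle[OF submult] _ _ _ \<mu> \<nu> w])
    show "0 \<le> ln B" using B(1) by simp
    show "N (cocycle a x n) \<le> exp (ln B)" if "x \<in> seq_space I" for x
      using B(1) B(2)[OF that] by simp
    show "\<forall>\<^sub>F m in sequentially. ereal (real n * r) \<le> eintegral (\<mu> m) (\<lambda>x. elog (N (cocycle a x n)))"
      using le n by (simp add: mean_log_def le_ereal_scale_iff real)
  qed (rule submult_norm_nonneg[OF submult])
  then show ?thesis using n by (simp add: mean_log_def le_ereal_scale_iff real)
next
  case PInf
  obtain m where "c \<le> mean_log N a (\<mu> m) n"
    using eventually_happens[OF le] by auto
  then show ?thesis
    using mean_log_le_growth[OF \<mu>, of m n] scaled_growth_finite[of n] PInf by simp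
qed simp

text \<open>For an extremal sequence \<open>y\<close>, subadditivity gives
  \<open>f\<^sub>n(\<sigma>\<^sup>i y) \<ge> f\<^sub>i\<^sub>+\<^sub>n(y) - f\<^sub>i(y)\<close> for \<open>f\<^sub>n(x) = ln (N (cocycle a x n))\<close>, and these lower bounds telescope in
  the averages along the orbit of \<open>y\<close>.\<close>

theorem exists_maximizing_measure:
  "\<exists>\<mu>\<in>invariant_measures I. \<forall>n\<ge>1. log_jsr \<le> mean_log N a \<mu> n"
proof -
  define R where "R = joint_spectral_radius (a ` I)"
  have R: "0 \<le> R" "elog R = log_jsr" using joint_spectral_radius_eq by (simp_all add: R_def)
  obtain y where y: "y \<in> seq_space I" "\<And>k. k \<ge> 1 \<Longrightarrow> R ^ k \<le> N (cocycle a y k)"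
    using exists_extremal_sequence[OF R] by blast
  obtain r \<nu> where r: "strict_mono (r :: nat \<Rightarrow> nat)" and \<nu>: "\<nu> \<in> invariant_probs (seq_space I) shift"
    and lim: "\<And>f :: (nat \<Rightarrow> 'i) \<Rightarrow> real. continuous_on (seq_space I) f \<Longrightarrow>
      (\<lambda>m. (\<Sum>i\<le>r m. f ((shift ^^ i) y)) / Suc (r m)) \<longlonglongrightarrow> (\<integral>x. f x \<partial>\<nu>)"
    by (rule krylov_bogoliubov[OF compact_X continuous_on_shift shift_seq_space y(1)]) (rule that)
  have \<nu>B: "\<nu> \<in> borel_probs (seq_space I)" using \<nu> by (simp add: invariant_probs_def)
  have "log_jsr \<le> mean_log N a \<nu> n" if n: "n \<ge> 1" for n
  proof (cases "R = 0")
    case True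
    then show ?thesis unfolding R(2)[symmetric] by (simp add: elog_def)
  next
    case False
    then have R0: "0 < R" using R(1) by simp
    obtain B where B: "1 \<le> B" "\<And>x. x \<in> seq_space I \<Longrightarrow> N (cocycle a x n) \<le> B"
      using norm_cocycle_bounded[OF submult] by blast
    define K where "K = ln B"
    define v where "v i = ln (N (cocycle a y i))" for i
    have Npos: "0 < N (cocycle a y i)" for i
    proof (cases "i \<ge> 1")
      case True
      then show ?thesis using y(2)[of i] zero_less_power[OF R0, of i] by linarith
    next
      case False
      have "mat 1 \<noteq> (0 :: complex^'d^'d)" by (simp add: vec_eq_iff mat_def)
      then show ?thesis
        using False submult_norm_nonneg[OF submult, of "mat 1"] submult_norm_eq_0_iff[OF submult, of "mat 1"]
        by (simp add: not_le)
    qed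
    have v_lower: "real i * ln R \<le> v i" if "i \<ge> 1" for i
      using ln_mono[OF y(2)[OF that] zero_less_power[OF R0]] R0 by (simp add: v_def ln_realpow)
    define C where "C = (\<Sum>k<n. real k * ln R - v k)"
    have step: "v (i + n) - v i \<le> ln (N (cocycle a ((shift ^^ i) y) n))"
      and pos: "0 < N (cocycle a ((shift ^^ i) y) n)" for i
    proof -
      have le: "N (cocycle a y (i + n)) \<le> N (cocycle a ((shift ^^ i) y) n) * N (cocycle a y i)"
        unfolding cocycle_add by (rule submult_norm_mult[OF submult])
      then have "0 < N (cocycle a ((shift ^^ i) y) n) * N (cocycle a y i)"
        using Npos[of "i + n"] by linarith
      then show pos: "0 < N (cocycle a ((shift ^^ i) y) n)"
        using Npos[of i] by (simp add: zero_less_mult_iff)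
      show "v (i + n) - v i \<le> ln (N (cocycle a ((shift ^^ i) y) n))"
        using ln_mono[OF le Npos] pos Npos[of i] by (simp add: v_def ln_mult)
    qed
    \<comment> \<open>\<open>sum_shift_diff\<close> leaves \<open>n\<close> values at the far end,
      bounded below by extremality of \<open>y\<close> since their indices are at least 1, and
      \<open>n\<close> values at the start. The latter enter \<open>C\<close>, which is independent
      of \<open>m\<close> and disappears in the averages.\<close>
    have sum_lower: "real n * real (Suc m) * ln R + C \<le> (\<Sum>i\<le>m. v (i + n) - v i)" for m
    proof -
      have "real n * real (Suc m) * ln R + C = (\<Sum>k<n. real (Suc m + k) * ln R - v k)"
        by (simp add: C_def sum.distrib sum_subtractf algebra_simps)
      also have "\<dots> \<le> (\<Sum>k<n. v (Suc m + k) - v k)"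
        by (intro sum_mono diff_right_mono v_lower) simp
      also have "\<dots> = (\<Sum>i\<le>m. v (i + n) - v i)"
        using sum_shift_diff[of v n "Suc m"] by (simp only: lessThan_Suc_atMost)
      finally show ?thesis .
    qed
    have "ereal (real n * ln R) \<le> eintegral \<nu> (\<lambda>x. elog (N (cocycle a x n)))"
    proof (rule eintegral_elog_truncation[OF compact_X continuous_on_norm_cocycle[OF submult] _ _ _ \<nu>B])
      show "0 \<le> K" using B(1) by (simp add: K_def)
      show "N (cocycle a x n) \<le> exp K" if "x \<in> seq_space I" for x
        using B(1) B(2)[OF that] by (simp add: K_def)
      fix j
      define h where "h x = K - ln (max (N (cocycle a x n)) (exp (K - real j)))" for x
      have h_cont: "continuous_on (seq_space I) h"
        unfolding h_def
        by (rule continuous_on_truncated_ln[OF continuous_on_norm_cocycle[OF submult]])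
      \<comment> \<open>Truncation can only raise the logarithm, so the lower bound
        \<open>step\<close> survives it.\<close>
      have h_le: "h ((shift ^^ i) y) \<le> K - (v (i + n) - v i)" for i
      proof -
        have "ln (N (cocycle a ((shift ^^ i) y) n))
            \<le> ln (max (N (cocycle a ((shift ^^ i) y) n)) (exp (K - real j)))"
          using pos[of i] by (intro ln_mono) auto
        then show ?thesis using step[of i] by (simp add: h_def)
      qed
      have "(\<Sum>i\<le>r m. h ((shift ^^ i) y)) / Suc (r m) \<le> K - real n * ln R - C * inverse (real (Suc (r m)))" for m
      proof -
        have "(\<Sum>i\<le>r m. h ((shift ^^ i) y)) \<le> (\<Sum>i\<le>r m. K - (v (i + n) - v i))"
          by (intro sum_mono h_le)
        also have "\<dots> = real (Suc (r m)) * K - (\<Sum>i\<le>r m. v (i + n) - v i)"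
          by (simp add: sum_subtractf)
        also have "\<dots> \<le> real (Suc (r m)) * K - (real n * real (Suc (r m)) * ln R + C)"
          using sum_lower[of "r m"] by linarith
        also have "\<dots> = (K - real n * ln R - C * inverse (real (Suc (r m)))) * real (Suc (r m))"
          by (simp add: field_simps del: of_nat_Suc)
        finally show ?thesis by (simp add: divide_le_eq del: of_nat_Suc)
      qed
      moreover have "(\<lambda>m. K - real n * ln R - C * inverse (real (Suc (r m))))
          \<longlonglongrightarrow> K - real n * ln R - C * 0"
        using LIMSEQ_subseq_LIMSEQ[OF LIMSEQ_inverse_real_of_nat r]
        by (intro tendsto_intros) (simp add: o_def)
      ultimately have "(\<integral>x. h x \<partial>\<nu>) \<le> K - real n * ln R - C * 0"
        using lim[OF h_cont] by (intro LIMSEQ_le) auto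
      then show "(\<integral>x. K - ln (max (N (cocycle a x n)) (exp (K - real j))) \<partial>\<nu>) \<le> K - real n * ln R"
        by (simp add: h_def)
    qed (rule submult_norm_nonneg[OF submult])
    moreover have "log_jsr = ereal (ln R)" using R(2) False by (simp add: elog_def)
    ultimately show ?thesis
      using n by (simp add: mean_log_def le_ereal_scale_iff)
  qed
  then show ?thesis using \<nu> by (auto simp: invariant_measures_eq)
qed

section \<open>Ergodic maximizing measures\<close>

lemma ergodic_in_invariant_face:
  assumes M: "M \<subseteq> invariant_measures I" "M \<noteq> {}"
    and closed: "\<And>\<mu> \<nu>. (\<And>m. \<mu> m \<in> M) \<Longrightarrow> \<nu> \<in> invariant_measures I
      \<Longrightarrow> weak_limit (seq_space I) \<mu> \<nu> \<Longrightarrow> \<nu> \<in> M"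
    and face: "\<And>\<mu> \<mu>' \<nu> t. \<nu> \<in> M \<Longrightarrow> \<mu> \<in> invariant_measures I \<Longrightarrow> \<mu>' \<in> invariant_measures I
      \<Longrightarrow> 0 < t \<Longrightarrow> t < 1 \<Longrightarrow> mixture t \<mu> \<mu>' \<nu> \<Longrightarrow> \<mu> \<in> M"
  shows "\<exists>\<nu>\<in>M. ergodic \<nu>"
  unfolding ergodic_def using assms unfolding invariant_measures_eq
  by (intro ergodic_in_face[OF compact_X continuous_on_shift shift_seq_space]) blast+

lemma INF_mean_log_le:
  assumes "\<mu> \<in> invariant_measures I"
  shows "(INF n\<in>{1..}. mean_log N a \<mu> n) \<le> log_jsr"
  unfolding log_jsr_def by (intro INF_mono) (use mean_log_le_growth[OF invariant_borel[OF assms]] in blast)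

text \<open>\<open>M\<close> is described by one inequality per \<open>n\<close>, each preserved by
  weak limits. For the face property an infimum is awkward, not being affine in the measure; but for
  invariant measures it is the limit of the values \<open>mean_log N a \<mu> n\<close>, which are
  affine for \<open>n \<ge> 1\<close>, and the limit inherits this.\<close>

lemma exists_ergodic_maximizing_measure:
  "\<exists>\<nu>\<in>invariant_measures I. ergodic \<nu> \<and> (INF n\<in>{1..}. mean_log N a \<nu> n) = log_jsr"
proof -
  define M where "M = {\<mu> \<in> invariant_measures I. \<forall>n\<ge>1. log_jsr \<le> mean_log N a \<mu> n}"
  have INF_M: "(INF n\<in>{1..}. mean_log N a \<mu> n) = log_jsr" if "\<mu> \<in> M" for \<mu>
    using that INF_mean_log_le[of \<mu>] by (intro antisym INF_greatest) (auto simp: M_def)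
  have "\<exists>\<nu>\<in>M. ergodic \<nu>"
  proof (rule ergodic_in_invariant_face)
    show "M \<subseteq> invariant_measures I" "M \<noteq> {}"
      using exists_maximizing_measure by (auto simp: M_def)
    show "\<nu> \<in> M" if \<mu>: "\<And>m. \<mu> m \<in> M" and \<nu>: "\<nu> \<in> invariant_measures I"
      and w: "weak_limit (seq_space I) \<mu> \<nu>" for \<mu> \<nu>
    proof -
      have "log_jsr \<le> mean_log N a \<nu> n" if n: "n \<ge> 1" for n
      proof (rule mean_log_weak_limit[OF _ invariant_borel[OF \<nu>] w n])
        show "\<mu> m \<in> borel_probs (seq_space I)" for m
          using \<mu>[of m] by (intro invariant_borel) (simp add: M_def)
        show "\<forall>\<^sub>F m in sequentially. log_jsr \<le> mean_log N a (\<mu> m) n"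
          using \<mu> n by (simp add: M_def)
      qed
      then show ?thesis using \<nu> by (simp add: M_def)
    qed
    show "\<mu> \<in> M" if \<nu>: "\<nu> \<in> M" and \<mu>: "\<mu> \<in> invariant_measures I" and \<mu>': "\<mu>' \<in> invariant_measures I"
      and t: "0 < t" "t < 1" and mix: "mixture t \<mu> \<mu>' \<nu>" for \<mu> \<mu>' \<nu> t
    proof -
      define i where "i \<kappa> = (INF n\<in>{1..}. mean_log N a \<kappa> n)" for \<kappa>
      have \<nu>I: "\<nu> \<in> invariant_measures I" using \<nu> by (simp add: M_def)
      have le: "i \<mu> \<le> log_jsr" "i \<mu>' \<le> log_jsr"
        using INF_mean_log_le \<mu> \<mu>' by (simp_all add: i_def)
      have i_fin: "i \<mu> < \<infinity>" "i \<mu>' < \<infinity>"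
        using le log_jsr_finite by (auto intro: le_less_trans)
      have lims: "(\<lambda>n. mean_log N a \<mu> n) \<longlonglongrightarrow> i \<mu>" "(\<lambda>n. mean_log N a \<mu>' n) \<longlonglongrightarrow> i \<mu>'"
        unfolding i_def by (rule mean_log_tendsto[OF \<mu>] mean_log_tendsto[OF \<mu>'])+
      have "(\<lambda>n. ereal t * mean_log N a \<mu> n + ereal (1 - t) * mean_log N a \<mu>' n)
          \<longlonglongrightarrow> ereal t * i \<mu> + ereal (1 - t) * i \<mu>'"
        using t i_fin lims by (intro tendsto_add_ereal_general tendsto_cmult_ereal) auto
      moreover have "\<forall>\<^sub>F n in sequentially. mean_log N a \<nu> n
          = ereal t * mean_log N a \<mu> n + ereal (1 - t) * mean_log N a \<mu>' n"
        using mean_log_mixture[OF invariant_borel[OF \<mu>] invariant_borel[OF \<mu>'] invariant_borel[OF \<nu>I] mix t]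
        by (intro eventually_mono[OF eventually_ge_at_top[of 1]])
      ultimately have "(\<lambda>n. mean_log N a \<nu> n) \<longlonglongrightarrow> ereal t * i \<mu> + ereal (1 - t) * i \<mu>'"
        by (simp cong: tendsto_cong)
      then have "log_jsr = ereal t * i \<mu> + ereal (1 - t) * i \<mu>'"
        using mean_log_tendsto[OF \<nu>I] INF_M[OF \<nu>] by (simp add: LIMSEQ_unique)
      then have "i \<mu> = log_jsr"
        using le log_jsr_finite t by (intro ereal_convex_combination_eq_max[of _ _ "i \<mu>'" t]) auto
      then have "log_jsr \<le> mean_log N a \<mu> n" if "n \<ge> 1" for n
        using that by (metis INF_lower atLeast_iff i_def)
      then show ?thesis using \<mu> by (simp add: M_def)
    qed
  qed
  then show ?thesis using INF_M by (auto simp: M_def)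
qed

text \<open>By upper semicontinuity a weak limit of a maximizing sequence is maximizing. For a fixed
  \<open>n\<close> the functional is affine, so its maximizers form a face.\<close>

lemma exists_ergodic_maximizing_mean_log:
  assumes n: "n \<ge> 1"
  shows "\<exists>\<nu>\<in>invariant_measures I. ergodic \<nu>
    \<and> mean_log N a \<nu> n = (SUP \<mu>\<in>invariant_measures I. mean_log N a \<mu> n)"
proof -
  define s where "s = (SUP \<mu>\<in>invariant_measures I. mean_log N a \<mu> n)"
  have le_s: "mean_log N a \<mu> n \<le> s" if "\<mu> \<in> invariant_measures I" for \<mu>
    unfolding s_def using that by (rule SUP_upper)
  have "s \<le> ereal (1 / real n) * growth n"
    unfolding s_def by (intro SUP_least mean_log_le_growth invariant_borel)
  then have s_fin: "s < \<infinity>" using scaled_growth_finite by (rule le_less_trans)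
  define M where "M = {\<mu> \<in> invariant_measures I. s \<le> mean_log N a \<mu> n}"
  have "invariant_measures I \<noteq> {}" using exists_maximizing_measure by blast
  \<comment> \<open>\<open>s\<close> may be \<open>- \<infinity>\<close>, so an increasing sequence
    of values with supremum \<open>s\<close> replaces approximation within
    \<open>1 / m\<close>.\<close>
  then obtain f :: "nat \<Rightarrow> ereal" where f: "incseq f"
    "range f \<subseteq> (\<lambda>\<mu>. mean_log N a \<mu> n) ` invariant_measures I" "s = (SUP i. f i)"
    using Sup_countable_SUP[of "(\<lambda>\<mu>. mean_log N a \<mu> n) ` invariant_measures I"] by (auto simp: s_def)
  have "\<exists>\<mu>\<in>invariant_measures I. mean_log N a \<mu> n = f m" for m
  proof -
    have "f m \<in> (\<lambda>\<mu>. mean_log N a \<mu> n) ` invariant_measures I" using f(2) by blast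
    then obtain \<mu> where "\<mu> \<in> invariant_measures I" "f m = mean_log N a \<mu> n" by (rule imageE)
    then show ?thesis by (intro bexI[of _ \<mu>]) simp_all
  qed
  then obtain \<mu> where \<mu>: "\<And>m. \<mu> m \<in> invariant_measures I" "\<And>m. mean_log N a (\<mu> m) n = f m"
    by metis
  have \<mu>': "\<mu> m \<in> invariant_probs (seq_space I) shift" for m
    using \<mu>(1)[of m] by (simp add: invariant_measures_eq)
  obtain r \<nu> where r: "strict_mono (r :: nat \<Rightarrow> nat)" and \<nu>: "\<nu> \<in> invariant_probs (seq_space I) shift"
    and w: "weak_limit (seq_space I) (\<mu> \<circ> r) \<nu>"
    by (rule invariant_probs_weakly_compact[OF compact_X continuous_on_shift shift_seq_space \<mu>'])
  have \<nu>I: "\<nu> \<in> invariant_measures I" using \<nu> by (simp add: invariant_measures_eq)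
  have "f k \<le> mean_log N a \<nu> n" for k
  proof (rule mean_log_weak_limit[OF _ invariant_borel[OF \<nu>I] w n])
    show "(\<mu> \<circ> r) m \<in> borel_probs (seq_space I)" for m
      using \<mu>(1) by (simp add: invariant_borel)
    show "\<forall>\<^sub>F m in sequentially. f k \<le> mean_log N a ((\<mu> \<circ> r) m) n"
      using eventually_ge_at_top[of k]
    proof eventually_elim
      case (elim m)
      then have "k \<le> r m" using seq_suble[OF r, of m] by simp
      then show ?case using f(1) \<mu>(2) by (simp add: incseqD)
    qed
  qed
  then have "s \<le> mean_log N a \<nu> n" unfolding f(3) by (rule SUP_least)
  then have "\<nu> \<in> M" using \<nu>I by (simp add: M_def)
  have "\<exists>\<nu>\<in>M. ergodic \<nu>"
  proof (rule ergodic_in_invariant_face)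
    show "M \<subseteq> invariant_measures I" "M \<noteq> {}"
      using \<open>\<nu> \<in> M\<close> by (auto simp: M_def)
    show "\<kappa> \<in> M" if \<mu>: "\<And>m. \<mu> m \<in> M" and \<kappa>: "\<kappa> \<in> invariant_measures I"
      and w: "weak_limit (seq_space I) \<mu> \<kappa>" for \<mu> \<kappa>
    proof -
      have "s \<le> mean_log N a \<kappa> n"
      proof (rule mean_log_weak_limit[OF _ invariant_borel[OF \<kappa>] w n])
        show "\<mu> m \<in> borel_probs (seq_space I)" for m
          using \<mu>[of m] by (intro invariant_borel) (simp add: M_def)
        show "\<forall>\<^sub>F m in sequentially. s \<le> mean_log N a (\<mu> m) n"
          using \<mu> by (simp add: M_def)
      qed
      then show ?thesis using \<kappa> by (simp add: M_def)
    qed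
    show "\<mu> \<in> M" if \<nu>: "\<nu> \<in> M" and \<mu>: "\<mu> \<in> invariant_measures I" and \<mu>': "\<mu>' \<in> invariant_measures I"
      and t: "0 < t" "t < 1" and mix: "mixture t \<mu> \<mu>' \<nu>" for \<mu> \<mu>' \<nu> t
    proof -
      have \<nu>I: "\<nu> \<in> invariant_measures I" and le: "s \<le> mean_log N a \<nu> n"
        using \<nu> by (simp_all add: M_def)
      have "s \<le> ereal t * mean_log N a \<mu> n + ereal (1 - t) * mean_log N a \<mu>' n"
        using le mean_log_mixture[OF invariant_borel[OF \<mu>] invariant_borel[OF \<mu>'] invariant_borel[OF \<nu>I] mix t n]
        by simp
      then have "mean_log N a \<mu> n = s"
        using le_s[OF \<mu>] le_s[OF \<mu>'] s_fin t by (intro ereal_convex_combination_eq_max)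
      then show ?thesis using \<mu> by (simp add: M_def)
    qed
  qed
  then show ?thesis using le_s by (auto simp: M_def s_def intro: antisym)
qed

lemma exists_maximizing_sequence:
  "\<exists>y\<in>seq_space I. log_jsr \<le> (INF n\<in>{1..}. ereal (1 / real n) * elog (N (cocycle a y n)))"
proof -
  define R where "R = joint_spectral_radius (a ` I)"
  have R: "0 \<le> R" "elog R = log_jsr" using joint_spectral_radius_eq by (simp_all add: R_def)
  obtain y where y: "y \<in> seq_space I" "\<And>k. k \<ge> 1 \<Longrightarrow> R ^ k \<le> N (cocycle a y k)"
    using exists_extremal_sequence[OF R] by blast
  have "log_jsr \<le> ereal (1 / real n) * elog (N (cocycle a y n))" if n: "n \<ge> 1" for n
  proof -
    have "R = root n (R ^ n)" using R(1) n by (simp add: real_root_power_cancel)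
    also have "\<dots> \<le> root n (N (cocycle a y n))" using y(2)[OF n] n by simp
    finally have "elog R \<le> elog (root n (N (cocycle a y n)))" by (rule elog_mono[OF R(1)])
    then show ?thesis using R(2) n by (simp add: elog_root submult_norm_nonneg[OF submult])
  qed
  then show ?thesis using y(1) by (intro bexI[of _ y] INF_greatest) auto
qed

end

theorem theorem2p1:
  fixes A :: "(complex^'d^'d) set"
    and I :: "'i::metric_space set"
    and a :: "'i \<Rightarrow> complex^'d^'d"
    and N :: "complex^'d^'d \<Rightarrow> real"
  assumes "A \<noteq> {}"
    and "compact A"
    and "indexed_by A I a"
    and "submult_norm N"
  shows
    "elog (joint_spectral_radius A)
       = (SUP \<mu> \<in> invariant_measures I. INF n \<in> {1..}. mean_log N a \<mu> n) \<and>
     elog (joint_spectral_radius A)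
       = (INF n \<in> {1..}. SUP \<mu> \<in> invariant_measures I. mean_log N a \<mu> n) \<and>
     elog (joint_spectral_radius A)
       = (SUP x \<in> seq_space I. INF n \<in> {1..}. ereal (1 / real n) * elog (N (cocycle a x n))) \<and>
     (\<exists>\<nu> \<in> invariant_measures I. ergodic \<nu> \<and>
        (INF n \<in> {1..}. mean_log N a \<nu> n)
          = (SUP \<mu> \<in> invariant_measures I. INF n \<in> {1..}. mean_log N a \<mu> n)) \<and>
     (\<forall>n \<ge> 1. \<exists>\<nu> \<in> invariant_measures I. ergodic \<nu> \<and>
        mean_log N a \<nu> n = (SUP \<mu> \<in> invariant_measures I. mean_log N a \<mu> n)) \<and>
     (\<exists>y \<in> seq_space I.
        (INF n \<in> {1..}. ereal (1 / real n) * elog (N (cocycle a y n)))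
          = (SUP x \<in> seq_space I. INF n \<in> {1..}. ereal (1 / real n) * elog (N (cocycle a x n)))) \<and>
     (\<forall>\<mu> \<in> invariant_measures I. convergent (\<lambda>n. mean_log N a \<mu> n)) \<and>
     elog (joint_spectral_radius A)
       = (SUP \<mu> \<in> invariant_measures I. lim (\<lambda>n. mean_log N a \<mu> n)) \<and>
     (\<lambda>n. SUP \<mu> \<in> invariant_measures I. mean_log N a \<mu> n)
       \<longlonglongrightarrow> elog (joint_spectral_radius A)"
proof -
  interpret indexed_cocycle I a N
    using assms by unfold_locales (auto simp: indexed_by_def)
  have A: "A = a ` I" using assms(3) by (simp add: indexed_by_def)
  have jsr: "elog (joint_spectral_radius A) = log_jsr"
    unfolding A by (rule joint_spectral_radius_eq)
  obtain \<nu> where \<nu>: "\<nu> \<in> invariant_measures I" "ergodic \<nu>" "(INF n\<in>{1..}. mean_log N a \<nu> n) = log_jsr"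
    using exists_ergodic_maximizing_measure by blast
  have SUP_INF: "(SUP \<mu>\<in>invariant_measures I. INF n\<in>{1..}. mean_log N a \<mu> n) = log_jsr"
  proof (rule antisym)
    show "log_jsr \<le> (SUP \<mu>\<in>invariant_measures I. INF n\<in>{1..}. mean_log N a \<mu> n)"
      using \<nu>(1,3) by (intro SUP_upper2) auto
  qed (intro SUP_least INF_mean_log_le)
  \<comment> \<open>One measure \<open>\<nu>\<close> serves all \<open>n\<close> and bounds every
    supremum from below, while \<open>SUP_upper\<close> bounds it by the growth rates; this forces
    both the infimum and the limit over \<open>n\<close> to be \<open>log_jsr\<close>.\<close>
  have SUP_lower: "log_jsr \<le> (SUP \<mu>\<in>invariant_measures I. mean_log N a \<mu> n)" if "n \<ge> 1" for n
  proof -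
    have "log_jsr \<le> mean_log N a \<nu> n"
      unfolding \<nu>(3)[symmetric] using that by (intro INF_lower) simp
    also have "\<dots> \<le> (SUP \<mu>\<in>invariant_measures I. mean_log N a \<mu> n)"
      using \<nu>(1) by (rule SUP_upper)
    finally show ?thesis .
  qed
  have SUP_upper: "(SUP \<mu>\<in>invariant_measures I. mean_log N a \<mu> n) \<le> ereal (1 / real n) * growth n" for n
    by (intro SUP_least mean_log_le_growth invariant_borel)
  have INF_SUP: "(INF n\<in>{1..}. SUP \<mu>\<in>invariant_measures I. mean_log N a \<mu> n) = log_jsr"
  proof (rule antisym)
    show "(INF n\<in>{1..}. SUP \<mu>\<in>invariant_measures I. mean_log N a \<mu> n) \<le> log_jsr"
      unfolding log_jsr_def using SUP_upper by (intro INF_mono) blast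
  qed (intro INF_greatest, simp add: SUP_lower)
  have lim_SUP: "(\<lambda>n. SUP \<mu>\<in>invariant_measures I. mean_log N a \<mu> n) \<longlonglongrightarrow> log_jsr"
  proof (rule tendsto_sandwich[OF _ _ tendsto_const growth_tendsto])
    show "\<forall>\<^sub>F n in sequentially. log_jsr \<le> (SUP \<mu>\<in>invariant_measures I. mean_log N a \<mu> n)"
      using SUP_lower by (intro eventually_mono[OF eventually_ge_at_top[of 1]])
  qed (simp add: SUP_upper)
  have lim_eq: "lim (\<lambda>n. mean_log N a \<mu> n) = (INF n\<in>{1..}. mean_log N a \<mu> n)"
    if "\<mu> \<in> invariant_measures I" for \<mu>
    using mean_log_tendsto[OF that] by (rule limI)
  have SUP_lim: "(SUP \<mu>\<in>invariant_measures I. lim (\<lambda>n. mean_log N a \<mu> n)) = log_jsr"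
    using SUP_INF lim_eq by (simp cong: SUP_cong)
  define s where "s x = (INF n\<in>{1..}. ereal (1 / real n) * elog (N (cocycle a x n)))" for x
  obtain y where y: "y \<in> seq_space I" "log_jsr \<le> s y"
    using exists_maximizing_sequence by (auto simp: s_def)
  have s_le: "s x \<le> log_jsr" if "x \<in> seq_space I" for x
    unfolding s_def log_jsr_def
  proof (rule INF_mono)
    fix n :: nat assume "n \<in> {1..}"
    then show "\<exists>m\<in>{1..}. ereal (1 / real m) * elog (N (cocycle a x m)) \<le> ereal (1 / real n) * growth n"
      by (intro bexI[of _ n] ereal_mult_left_mono elog_cocycle_le_growth that) simp_all
  qed
  have s_y: "s y = log_jsr" using y s_le by (intro antisym) auto
  have SUP_s: "(SUP x\<in>seq_space I. s x) = log_jsr"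
    using s_y y(1) s_le by (intro antisym SUP_least SUP_upper2[of y]) auto
  show ?thesis
    unfolding jsr SUP_INF INF_SUP SUP_lim s_def[symmetric] SUP_s
    using \<nu> exists_ergodic_maximizing_mean_log y(1) s_y mean_log_tendsto lim_SUP
    by (auto intro: convergentI)
qed

end
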